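(* Consider the equation $$x'(t)=\sum_{k=1}^{M}\lambda_k r_k(t)\frac{x^{m_k}(t-\tau_k(t))}{1+x^{n_k}(t-\mu_k(t))}-b(t)x(t)\qquad( * )$$ and assume that $m_k\le n_k+1$ for all $k\in\{1,\dots,M\}$ and $m_j=n_j+1$ for some $j$. \begin{enumerate} \item Let $m_k>1$ for all $k$ and $1<m_i<n_i+1$ for some $i$. Assume that $\sum_{k\in M_4}\lambda_k r_k(t)e^{Cn_k}<b(t)$ for all $t$ and that there exists a constant $\gamma_1$ such that $\alpha(\gamma_1,t)>0$ for all $t$. Then $( * )$ admits at least $2$ positive $T$-periodic solutions. \item Let $0<m_i<1$ for some $i$ and $m_k\notin(1,n_k+1)$ for all $k$. Assume that $\sum_{k\in M_4}\lambda_k r_k(t)e^{-Cm_k}>b(t)$ for all $t$ and that there exists $\gamma_1$ such that $\beta(\gamma_1,t)<0$ for all $t$. Then $( * )$ admits at least $2$ positive $T$-periodic solutions. \item Let $0<m_i<1$ and $1<m_s<n_s+1$ for some $i,s$. Assume that $\sum_{k\in M_4}\lambda_k r_k(t)e^{Cn_k}<b(t)$ for all $t$ and that there exist constants $\gamma_1<\gamma_2$ such that $\alpha(\gamma_2,t)>0>\beta(\gamma_1,t)$ for all $t$. Then $( * )$ has at least $3$ positive $T$-periodic solutions. \end{enumerate}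
   Context: Let $T>0$ and let $M\ge 1$ be an integer. For $k=1,\dots,M$, let $\lambda_k,m_k,n_k$ be positive real constants, and let $r_k,\tau_k,\mu_k$ and $b$ be continuous, positive, $T$-periodic functions $\mathbb{R}\to\mathbb{R}$. Set $C:=\int_0^T b(t)\,dt$ and $M_4:=\{k: m_k=n_k+1\}$. For $\gamma,t\in\mathbb{R}$ define $$\alpha(\gamma,t):=\sum_{k=1}^{M}\lambda_k r_k(t)\frac{e^{(m_k-1)\gamma}e^{-Cm_k}}{1+e^{n_k(\gamma+C)}}-b(t),\qquad \beta(\gamma,t):=\sum_{k=1}^{M}\lambda_k r_k(t)\frac{e^{(m_k-1)\gamma}e^{Cm_k}}{1+e^{n_k(\gamma-C)}}-b(t).$$ The constants $\gamma_i$ are real. Here $x^{m}(s)$ means $(x(s))^{m}$. A positive $T$-periodic solution is a $T$-periodic differentiable function $x:\mathbb{R}\to(0,\infty)$ satisfying the equation for all $t\in\mathbb{R}$; solutions are counted as distinct functions. *)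

theory Defs
  imports "HOL-Analysis.Analysis" "HOL-Library.Periodic_Fun"
begin

definition continuous_positive_periodic :: "real \<Rightarrow> (real \<Rightarrow> real) \<Rightarrow> bool" where
  "continuous_positive_periodic T f \<longleftrightarrow>
     continuous_on UNIV f \<and> (\<forall>t. f t > 0) \<and> periodic_fun_simple f T"

definition Cint :: "real \<Rightarrow> (real \<Rightarrow> real) \<Rightarrow> real" where
  "Cint T b = integral {0..T} b"

text \<open>In what follows the families are indexed by \<open>nat\<close>, but only the indices in \<open>{1..M}\<close> matter.\<close>

definition M4 :: "nat \<Rightarrow> (nat \<Rightarrow> real) \<Rightarrow> (nat \<Rightarrow> real) \<Rightarrow> nat set" where
  "M4 M m n = {k \<in> {1..M}. m k = n k + 1}"

definition alpha ::
  "real \<Rightarrow> nat \<Rightarrow> (nat \<Rightarrow> real) \<Rightarrow> (nat \<Rightarrow> real) \<Rightarrow> (nat \<Rightarrow> real) \<Rightarrow>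
   (nat \<Rightarrow> real \<Rightarrow> real) \<Rightarrow> (real \<Rightarrow> real) \<Rightarrow> real \<Rightarrow> real \<Rightarrow> real" where
  "alpha T M lam m n r b \<gamma> t =
     (\<Sum>k=1..M. lam k * r k t *
        (exp ((m k - 1) * \<gamma>) * exp (- Cint T b * m k) / (1 + exp (n k * (\<gamma> + Cint T b))))) - b t"

definition beta ::
  "real \<Rightarrow> nat \<Rightarrow> (nat \<Rightarrow> real) \<Rightarrow> (nat \<Rightarrow> real) \<Rightarrow> (nat \<Rightarrow> real) \<Rightarrow>
   (nat \<Rightarrow> real \<Rightarrow> real) \<Rightarrow> (real \<Rightarrow> real) \<Rightarrow> real \<Rightarrow> real \<Rightarrow> real" where
  "beta T M lam m n r b \<gamma> t =
     (\<Sum>k=1..M. lam k * r k t *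
        (exp ((m k - 1) * \<gamma>) * exp (Cint T b * m k) / (1 + exp (n k * (\<gamma> - Cint T b))))) - b t"

definition positive_periodic_solutions ::
  "real \<Rightarrow> nat \<Rightarrow> (nat \<Rightarrow> real) \<Rightarrow> (nat \<Rightarrow> real) \<Rightarrow> (nat \<Rightarrow> real) \<Rightarrow>
   (nat \<Rightarrow> real \<Rightarrow> real) \<Rightarrow> (nat \<Rightarrow> real \<Rightarrow> real) \<Rightarrow> (nat \<Rightarrow> real \<Rightarrow> real) \<Rightarrow>
   (real \<Rightarrow> real) \<Rightarrow> (real \<Rightarrow> real) set" where
  "positive_periodic_solutions T M lam m n r \<tau> \<mu> b =
     {x. (\<forall>t. x t > 0) \<and> periodic_fun_simple x T \<and>
         (\<forall>t. (x has_real_derivative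
                 ((\<Sum>k=1..M. lam k * r k t *
                     (x (t - \<tau> k t) powr m k / (1 + x (t - \<mu> k t) powr n k))) - b t * x t))
               (at t))}"

text \<open>\<open>card\<close> of an infinite set is \<open>0\<close>, so a lower bound on the number of elements is
  expressed through a finite subset.\<close>

definition has_at_least :: "nat \<Rightarrow> 'a set \<Rightarrow> bool" where
  "has_at_least N A \<longleftrightarrow> (\<exists>S \<subseteq> A. finite S \<and> card S = N)"

end

theory Submission
  imports Defs "HOL-Complex_Analysis.Great_Picard" "HOL-Real_Asymp.Real_Asymp"
begin

text \<open>Write \<open>x = exp y\<close>, so that the equation becomes \<open>y' = G y\<close> with \<open>G y \<ge> -b\<close>. A periodic \<open>y\<close>
  with \<open>y' \<ge> -b\<close> oscillates by at most \<open>C\<close>, which bounds the delayed values in terms of the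
  current one: whenever \<open>y t = \<gamma>\<close>, the value \<open>G y t\<close> lies between \<open>\<alpha> \<gamma> t\<close> and \<open>\<beta> \<gamma> t\<close>. Hence
  the levels in the hypotheses, together with suitable levels near \<open>\<plusminus>\<infinity>\<close>, are barriers at which the
  field has a strict sign, and they cut the line into strips on whose boundary the field points
  inwards or outwards. Each strip contains a periodic solution: clamp the argument of \<open>G\<close> to the
  strip and solve \<open>y' = G (clamp y) + \<sigma> (y - clamp y)\<close> by Schauder's theorem, with
  \<open>\<sigma> = -1\<close> for inward and \<open>\<sigma> = 1\<close> for outward pointing fields. Periodicity makes the two
  cases symmetric.\<close>

section \<open>Fixed point theorems of Brouwer and Schauder\<close>

lemma tendsto_fun_iff:
  fixes f :: "'c \<Rightarrow> 'a \<Rightarrow> 'b::topological_space"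
  shows "(f \<longlongrightarrow> l) F \<longleftrightarrow> (\<forall>i. ((\<lambda>x. f x i) \<longlongrightarrow> l i) F)"
  using limitin_componentwise[of "\<lambda>_. euclidean" UNIV f l F]
  by (simp add: euclidean_product_topology)

text \<open>The Hilbert cube, in the product topology of \<open>nat \<Rightarrow> real\<close>:
  compact, and metrizable, so that sequences suffice. It serves as one cube for all finite
  dimensions: the net in Schauder's theorem varies in size, and its weights are padded by
  zeros.\<close>

definition unit_cube :: "(nat \<Rightarrow> real) set" where
  "unit_cube = {x. \<forall>i. 0 \<le> x i \<and> x i \<le> 1}"

lemma compact_unit_cube: "compact unit_cube"
proof -
  have "unit_cube = PiE UNIV (\<lambda>_. {0..1})"
    by (auto simp: unit_cube_def PiE_def Pi_def)
  then show ?thesis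
    using compactin_PiE[of "\<lambda>_. euclidean :: real topology" "UNIV :: nat set" "\<lambda>_. {0..1}"]
    by (simp add: euclidean_product_topology)
qed

text \<open>Kuhn's combinatorial lemma on the first \<open>p\<close> coordinates gives a small cell
  carrying both labels in each of them. As \<open>p\<close> grows the cells accumulate at a point by
  compactness, and continuity turns the two opposite inequalities near it into an equality in every
  coordinate.\<close>

theorem brouwer_hilbert_cube:
  assumes cont: "continuous_on unit_cube F" and maps: "F ` unit_cube \<subseteq> unit_cube"
  shows "\<exists>x\<in>unit_cube. F x = x"
proof -
  have "\<forall>x. x \<in> unit_cube \<longrightarrow> F x \<in> unit_cube"
    "\<forall>x. x \<in> unit_cube \<longrightarrow> (\<forall>i. True \<longrightarrow> 0 \<le> x i \<and> x i \<le> 1)"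
    using maps by (auto simp: unit_cube_def)
  \<comment> \<open>Label 0 says that \<open>F\<close> does not decrease the coordinate, label 1
    that it does not increase it; on the faces of the cube the label is prescribed.\<close>
  from kuhn_labelling_lemma'[OF this] obtain l where l: "\<And>x i. l x i \<le> (1::nat)"
      "\<And>x i. x \<in> unit_cube \<Longrightarrow> x i = 0 \<Longrightarrow> l x i = 0"
      "\<And>x i. x \<in> unit_cube \<Longrightarrow> x i = 1 \<Longrightarrow> l x i = 1"
      "\<And>x i. x \<in> unit_cube \<Longrightarrow> l x i = 0 \<Longrightarrow> x i \<le> F x i"
      "\<And>x i. x \<in> unit_cube \<Longrightarrow> l x i = 1 \<Longrightarrow> F x i \<le> x i"
    by blast
  have l01: "l x i = 0 \<or> l x i = 1" for x i using l(1)[of x i] by linarith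
  \<comment> \<open>Grid points are scaled by \<open>p\<close> and padded by zeros. On the grid
    \<open>min 1\<close> changes nothing; it keeps the image in the cube for every argument.\<close>
  define emb :: "nat \<Rightarrow> (nat \<Rightarrow> nat) \<Rightarrow> nat \<Rightarrow> real"
    where "emb p x i = (if i < p then min 1 (real (x i) / real p) else 0)" for p x i
  have emb_cube: "emb p x \<in> unit_cube" for p x
    by (auto simp: emb_def unit_cube_def)
  \<comment> \<open>One number \<open>p\<close> is both the dimension and the fineness of the grid,
    so letting it grow reaches every coordinate and shrinks the cells at once. The witness
    \<open>z\<close> is the corner \<open>q\<close> of a Kuhn cell.\<close>
  have "\<exists>z\<in>unit_cube. \<forall>i<p. \<exists>r\<in>unit_cube. \<exists>s\<in>unit_cube.
           (\<forall>j. \<bar>r j - z j\<bar> \<le> 1 / real p) \<and> (\<forall>j. \<bar>s j - z j\<bar> \<le> 1 / real p)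
           \<and> r i \<le> F r i \<and> F s i \<le> s i" if "0 < p" for p :: nat
  proof -
    obtain q where q: "\<forall>i<p. q i < p"
      and rs: "\<forall>i<p. \<exists>r s. (\<forall>j<p. q j \<le> r j \<and> r j \<le> q j + 1) \<and>
          (\<forall>j<p. q j \<le> s j \<and> s j \<le> q j + 1) \<and> l (emb p r) i \<noteq> l (emb p s) i"
    proof (rule kuhn_lemma[of p p "\<lambda>x. l (emb p x)"])
      show "\<forall>x. (\<forall>i<p. x i \<le> p) \<longrightarrow> (\<forall>i<p. l (emb p x) i = 0 \<or> l (emb p x) i = 1)"
        using l01 by blast
      show "\<forall>x. (\<forall>i<p. x i \<le> p) \<longrightarrow> (\<forall>i<p. x i = 0 \<longrightarrow> l (emb p x) i = 0)"
        by (intro allI impI l(2) emb_cube) (simp add: emb_def)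
      show "\<forall>x. (\<forall>i<p. x i \<le> p) \<longrightarrow> (\<forall>i<p. x i = p \<longrightarrow> l (emb p x) i = 1)"
        using \<open>0 < p\<close> by (intro allI impI l(3) emb_cube) (simp add: emb_def)
    qed (use \<open>0 < p\<close> in auto)
    have close: "\<bar>emb p r j - emb p q j\<bar> \<le> 1 / real p"
      if "\<forall>j<p. q j \<le> r j \<and> r j \<le> q j + 1" for r j
    proof (cases "j < p")
      case True
      have "r j \<le> q j + 1" "q j < p" using that q True by auto
      then have "r j \<le> p" by simp
      then have "emb p r j = real (r j) / real p" "emb p q j = real (q j) / real p"
        using True q \<open>0 < p\<close> by (auto simp: emb_def min_def field_simps)
      moreover have "real (r j) - real (q j) \<le> 1" "real (q j) \<le> real (r j)"
        using that True by (force, simp)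
      ultimately show ?thesis
        by (simp add: diff_divide_distrib[symmetric] divide_right_mono)
    qed (simp add: emb_def)
    show ?thesis
    proof (rule bexI[OF _ emb_cube], intro allI impI)
      fix i assume "i < p"
      then obtain r s where r: "\<forall>j<p. q j \<le> r j \<and> r j \<le> q j + 1"
        and s: "\<forall>j<p. q j \<le> s j \<and> s j \<le> q j + 1" and ne: "l (emb p r) i \<noteq> l (emb p s) i"
        using rs by blast
      consider "l (emb p r) i = 0" "l (emb p s) i = 1" | "l (emb p r) i = 1" "l (emb p s) i = 0"
        using ne l01[of "emb p r" i] l01[of "emb p s" i] by linarith
      then show "\<exists>r\<in>unit_cube. \<exists>s\<in>unit_cube.
           (\<forall>j. \<bar>r j - emb p q j\<bar> \<le> 1 / real p) \<and> (\<forall>j. \<bar>s j - emb p q j\<bar> \<le> 1 / real p)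
           \<and> r i \<le> F r i \<and> F s i \<le> s i"
      proof cases
        case 1
        show ?thesis
          by (rule bexI[of _ "emb p r"], rule bexI[of _ "emb p s"])
            (simp_all add: close[OF r] close[OF s] l(4,5) emb_cube 1)
      next
        case 2
        show ?thesis
          by (rule bexI[of _ "emb p s"], rule bexI[of _ "emb p r"])
            (simp_all add: close[OF r] close[OF s] l(4,5) emb_cube 2)
      qed
    qed
  qed
  then have "\<forall>p. \<exists>z. z \<in> unit_cube \<and> (\<forall>i<Suc p. \<exists>r s. r \<in> unit_cube \<and> s \<in> unit_cube \<and>
           (\<forall>j. \<bar>r j - z j\<bar> \<le> 1 / real (Suc p)) \<and> (\<forall>j. \<bar>s j - z j\<bar> \<le> 1 / real (Suc p))
           \<and> r i \<le> F r i \<and> F s i \<le> s i)"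
    by (meson zero_less_Suc)
  then obtain Z where Z: "\<And>p. Z p \<in> unit_cube"
    and ZRS: "\<And>p i. i < Suc p \<Longrightarrow> \<exists>r s. r \<in> unit_cube \<and> s \<in> unit_cube \<and>
           (\<forall>j. \<bar>r j - Z p j\<bar> \<le> 1 / real (Suc p)) \<and> (\<forall>j. \<bar>s j - Z p j\<bar> \<le> 1 / real (Suc p))
           \<and> r i \<le> F r i \<and> F s i \<le> s i"
    by metis
  obtain z k where z: "z \<in> unit_cube" and k: "strict_mono (k :: nat \<Rightarrow> nat)"
    and lim: "(Z \<circ> k) \<longlonglongrightarrow> z"
    using seq_compactE[of unit_cube Z] compact_unit_cube Z
    unfolding compact_eq_seq_compact_metric by blast
  have approx: "X \<longlonglongrightarrow> z"
    if "\<forall>\<^sub>F p in sequentially. \<forall>j. \<bar>X p j - Z (k p) j\<bar> \<le> 1 / real (Suc (k p))" for X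
    unfolding tendsto_fun_iff
  proof
    fix j
    have inv: "(\<lambda>p. 1 / real (Suc (k p))) \<longlonglongrightarrow> 0"
      using LIMSEQ_subseq_LIMSEQ[OF LIMSEQ_inverse_real_of_nat k]
      by (simp add: o_def inverse_eq_divide)
    have "(\<lambda>p. X p j - Z (k p) j) \<longlonglongrightarrow> 0"
      by (rule Lim_null_comparison[OF _ inv]) (use that in eventually_elim, auto)
    moreover have "(\<lambda>p. Z (k p) j) \<longlonglongrightarrow> z j"
      using lim by (simp add: tendsto_fun_iff o_def)
    ultimately show "(\<lambda>p. X p j) \<longlonglongrightarrow> z j"
      using tendsto_add by fastforce
  qed
  have lim_F: "(\<lambda>p. F (X p) i) \<longlonglongrightarrow> F z i"
    if "X \<longlonglongrightarrow> z" "\<And>p. X p \<in> unit_cube" for X i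
    using cont that z unfolding continuous_on_sequentially tendsto_fun_iff o_def by blast
  have "F z i = z i" for i
  proof -
    \<comment> \<open>For the finitely many \<open>p\<close> with \<open>Suc (k p) \<le> i\<close>
      the grid does not see coordinate \<open>i\<close>; arbitrary points of the cube are chosen
      there to keep the sequences total.\<close>
    have "\<forall>p. \<exists>r s. r \<in> unit_cube \<and> s \<in> unit_cube \<and> (i < Suc (k p) \<longrightarrow>
           (\<forall>j. \<bar>r j - Z (k p) j\<bar> \<le> 1 / real (Suc (k p))) \<and>
           (\<forall>j. \<bar>s j - Z (k p) j\<bar> \<le> 1 / real (Suc (k p)))
           \<and> r i \<le> F r i \<and> F s i \<le> s i)"
      using ZRS Z by meson
    then obtain R S where RS: "\<And>p. R p \<in> unit_cube" "\<And>p. S p \<in> unit_cube"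
      "\<And>p. i < Suc (k p) \<Longrightarrow> (\<forall>j. \<bar>R p j - Z (k p) j\<bar> \<le> 1 / real (Suc (k p))) \<and>
           (\<forall>j. \<bar>S p j - Z (k p) j\<bar> \<le> 1 / real (Suc (k p)))
           \<and> R p i \<le> F (R p) i \<and> F (S p) i \<le> S p i"
      by metis
    have ev: "\<forall>\<^sub>F p in sequentially. i < Suc (k p)"
      using eventually_ge_at_top[of i]
      by eventually_elim (use seq_suble[OF k] in \<open>auto intro: le_trans simp: less_Suc_eq_le\<close>)
    have R: "R \<longlonglongrightarrow> z" by (rule approx) (use ev RS in \<open>auto elim!: eventually_mono\<close>)
    have S: "S \<longlonglongrightarrow> z" by (rule approx) (use ev RS in \<open>auto elim!: eventually_mono\<close>)
    have "(\<lambda>p. R p i) \<longlonglongrightarrow> z i" "(\<lambda>p. S p i) \<longlonglongrightarrow> z i"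
      using R S by (auto simp: tendsto_fun_iff)
    moreover have "\<forall>\<^sub>F p in sequentially. R p i \<le> F (R p) i"
      "\<forall>\<^sub>F p in sequentially. F (S p) i \<le> S p i"
      using ev by (eventually_elim, use RS(3) in blast)+
    ultimately have "z i \<le> F z i" "F z i \<le> z i"
      using tendsto_le[OF sequentially_bot lim_F[OF R RS(1)]]
        tendsto_le[OF sequentially_bot _ lim_F[OF S RS(2)]] by blast+
    then show ?thesis by simp
  qed
  then show ?thesis using z by auto
qed

text \<open>A finite \<open>e\<close>-net with its partition of unity replaces \<open>f\<close> by a
  self-map of the cube of weights: from weights to a convex combination, then \<open>f\<close>, then
  the weights of the image. Its fixed point yields a point that \<open>f\<close> moves by at most
  \<open>e\<close>, and compactness removes the \<open>e\<close>.\<close>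

theorem schauder_fixed_point:
  fixes S :: "'a::real_normed_vector set"
  assumes "compact S" "convex S" "S \<noteq> {}" and cont: "continuous_on S f" and maps: "f ` S \<subseteq> S"
  shows "\<exists>x\<in>S. f x = x"
proof -
  have approx: "\<exists>x\<in>S. dist (f x) x \<le> e" if "e > 0" for e
  proof -
    obtain K where K: "finite K" "K \<subseteq> S" "S \<subseteq> (\<Union>x\<in>K. ball x e)"
      using compactE_image[OF \<open>compact S\<close>, of S "\<lambda>x. ball x e"] \<open>e > 0\<close>
      by (metis (no_types, lifting) UN_I centre_in_ball open_ball subsetI)
    with \<open>S \<noteq> {}\<close> have "K \<noteq> {}" by auto
    obtain c n where c: "K = c ` {..<n::nat}"
      using finite_imp_nat_seg_image_inj_on[OF \<open>finite K\<close>] by (metis lessThan_def)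
    with \<open>K \<noteq> {}\<close> have "0 < n" by (cases n) auto
    have cS: "c i \<in> S" if "i < n" for i using that c K by auto
    \<comment> \<open>Tents of radius \<open>e\<close> around the net points. The net property makes
      their sum \<open>H\<close> positive on \<open>S\<close>, so normalising gives the partition of
      unity \<open>w\<close>.\<close>
    define h where "h i y = max 0 (e - dist y (c i))" for i y
    define H where "H y = (\<Sum>i<n. h i y)" for y
    define w where "w y i = (if i < n then h i y / H y else 0)" for y i
    have h_nonneg: "0 \<le> h i y" for i y by (simp add: h_def)
    have H_pos: "0 < H y" if "y \<in> S" for y
    proof -
      obtain i where "i < n" "dist y (c i) < e"
      proof -
        obtain x where "x \<in> K" "dist x y < e" using K(3) \<open>y \<in> S\<close> by auto
        then show ?thesis using that c by (auto simp: dist_commute)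
      qed
      then have "0 < h i y" by (simp add: h_def)
      with \<open>i < n\<close> show ?thesis unfolding H_def
        by (intro sum_pos2[of _ i]) (auto simp: h_nonneg)
    qed
    have w_sum: "(\<Sum>i<n. w y i) = 1" if "y \<in> S" for y
      using H_pos[OF that] by (simp add: w_def H_def sum_divide_distrib[symmetric])
    have w_nonneg: "0 \<le> w y i" if "y \<in> S" for y i
      using H_pos[OF that] h_nonneg by (simp add: w_def)
    have w_le: "w y i \<le> 1" if "y \<in> S" for y i
    proof (cases "i < n")
      case True
      then have "w y i \<le> (\<Sum>i<n. w y i)" by (intro member_le_sum) (auto simp: w_nonneg that)
      then show ?thesis by (simp add: w_sum that)
    qed (simp add: w_def)
    have h_cont: "continuous_on S (h i)" for i
      unfolding h_def by (intro continuous_intros)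
    then have "continuous_on S H" unfolding H_def by (intro continuous_intros)
    moreover have "\<forall>y\<in>S. H y \<noteq> 0" using H_pos by force
    ultimately have w_cont: "continuous_on S (\<lambda>y. w y i)" for i
      by (cases "i < n") (auto simp: w_def intro!: continuous_on_divide h_cont)
    \<comment> \<open>The mass missing from a total of 1 goes to \<open>c 0\<close>; this retracts the whole cube
      onto the convex hull.\<close>
    define D where "D v = max 1 (\<Sum>i<n. v i)" for v :: "nat \<Rightarrow> real"
    define \<rho> where "\<rho> v = (\<Sum>i<n. (v i / D v) *\<^sub>R c i) + (1 - (\<Sum>i<n. v i) / D v) *\<^sub>R c 0"
      for v :: "nat \<Rightarrow> real"
    have D: "D v \<ge> 1" for v by (simp add: D_def)
    have \<rho>_mem: "\<rho> v \<in> S" if "v \<in> unit_cube" for v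
    proof -
      have "(\<Sum>i\<in>{..n}. (if i < n then v i / D v else 1 - (\<Sum>i<n. v i) / D v) *\<^sub>R
              (if i < n then c i else c 0)) \<in> S"
      proof (rule convex_sum)
        show "(\<Sum>i\<le>n. if i < n then v i / D v else 1 - (\<Sum>i<n. v i) / D v) = 1"
          by (simp add: atMost_Suc lessThan_Suc_atMost[symmetric] sum_divide_distrib)
        show "0 \<le> (if i < n then v i / D v else 1 - (\<Sum>i<n. v i) / D v)" if "i \<in> {..n}" for i
          using D[of v] \<open>v \<in> unit_cube\<close>
          by (auto simp: unit_cube_def D_def divide_le_eq)
      qed (use \<open>convex S\<close> cS \<open>0 < n\<close> in auto)
      then show ?thesis by (simp add: \<rho>_def lessThan_Suc_atMost[symmetric])
    qed
    have \<rho>_cont: "continuous_on unit_cube \<rho>"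
    proof -
      have 1: "continuous_on unit_cube (\<lambda>v. v i)" for i
        by (rule continuous_on_subset[OF continuous_on_product_coordinates]) simp
      have 2: "continuous_on unit_cube D" unfolding D_def
        by (intro continuous_intros 1)
      have "D v \<noteq> 0" for v using D[of v] by linarith
      then show ?thesis unfolding \<rho>_def
        by (intro continuous_intros 1 2) auto
    qed
    have "\<exists>v\<in>unit_cube. (\<lambda>v. w (f (\<rho> v))) v = v"
    proof (rule brouwer_hilbert_cube)
      show "(\<lambda>v. w (f (\<rho> v))) ` unit_cube \<subseteq> unit_cube"
        using maps \<rho>_mem w_nonneg w_le by (auto simp: unit_cube_def image_subset_iff)
      have fr: "continuous_on unit_cube (\<lambda>v. f (\<rho> v))"
        by (rule continuous_on_compose2[OF cont \<rho>_cont]) (use \<rho>_mem in auto)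
      show "continuous_on unit_cube (\<lambda>v. w (f (\<rho> v)))"
        by (rule continuous_on_coordinatewise_then_product,
            rule continuous_on_compose2[OF w_cont fr]) (use \<rho>_mem maps in auto)
    qed
    then obtain v where v: "v \<in> unit_cube" "w (f (\<rho> v)) = v" by auto
    define x where "x = \<rho> v"
    have x: "x \<in> S" and fx: "f x \<in> S" using v \<rho>_mem maps by (auto simp: x_def)
    \<comment> \<open>The fixed weights have total 1, so \<open>D v = 1\<close>, no mass is missing,
      and \<open>x\<close> is the combination of the net points with the weights of
      \<open>f x\<close>.\<close>
    have "(\<Sum>i<n. v i) = 1" using w_sum[OF fx] v by (simp add: x_def)
    then have sum_c: "(\<Sum>i<n. w (f x) i *\<^sub>R c i) = x"
      using v by (simp add: x_def \<rho>_def D_def)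
    have sum_f: "(\<Sum>i<n. w (f x) i *\<^sub>R f x) = f x"
      by (simp add: scaleR_sum_left[symmetric] w_sum[OF fx])
    have "(\<Sum>i<n. w (f x) i *\<^sub>R (f x - c i))
        = (\<Sum>i<n. w (f x) i *\<^sub>R f x) - (\<Sum>i<n. w (f x) i *\<^sub>R c i)"
      by (simp only: scaleR_right_diff_distrib sum_subtractf)
    then have "f x - x = (\<Sum>i<n. w (f x) i *\<^sub>R (f x - c i))"
      by (simp only: sum_c sum_f)
    then have "dist (f x) x = norm (\<Sum>i<n. w (f x) i *\<^sub>R (f x - c i))"
      by (simp only: dist_norm)
    also have "\<dots> \<le> (\<Sum>i<n. norm (w (f x) i *\<^sub>R (f x - c i)))" by (rule norm_sum)
    also have "\<dots> \<le> (\<Sum>i<n. w (f x) i * e)"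
    proof (rule sum_mono)
      fix i assume "i \<in> {..<n}"
      \<comment> \<open>Only net points closer than \<open>e\<close> to \<open>f x\<close> have
        positive weight.\<close>
      show "norm (w (f x) i *\<^sub>R (f x - c i)) \<le> w (f x) i * e"
      proof (cases "dist (f x) (c i) < e")
        case True
        then show ?thesis using w_nonneg[OF fx] by (auto simp: dist_norm intro!: mult_left_mono)
      next
        case False
        then have "w (f x) i = 0" by (simp add: w_def h_def)
        then show ?thesis by simp
      qed
    qed
    also have "\<dots> = e" by (simp add: sum_distrib_right[symmetric] w_sum[OF fx])
    finally show ?thesis using x by blast
  qed
  \<comment> \<open>The displacement attains its minimum on the compact set, and this minimum lies
    below every \<open>e\<close>.\<close>
  have "continuous_on S (\<lambda>x. dist (f x) x)" by (intro continuous_intros cont)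
  then obtain x where x: "x \<in> S" "\<And>y. y \<in> S \<Longrightarrow> dist (f x) x \<le> dist (f y) y"
    using continuous_attains_inf[OF \<open>compact S\<close> \<open>S \<noteq> {}\<close>] by blast
  then have "dist (f x) x \<le> e" if "e > 0" for e using approx[OF that] by force
  then have "dist (f x) x \<le> 0" by (rule field_le_epsilon[where y=0, simplified])
  then show ?thesis using x(1) by auto
qed

section \<open>Periodic functions and linear periodic equations\<close>

lemma periodic_representative:
  fixes f :: "real \<Rightarrow> 'a"
  assumes "periodic_fun_simple f T" "T > 0"
  obtains s' where "t \<le> s'" "s' \<le> t + T" "f s' = f s"
proof -
  interpret periodic_fun_simple f T by fact
  define k where "k = \<lfloor>(s - t) / T\<rfloor>"
  have "of_int k \<le> (s - t) / T" "(s - t) / T < of_int k + 1"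
    unfolding k_def by (simp_all add: floor_correct)
  then have "of_int k * T \<le> s - t" "s - t < (of_int k + 1) * T"
    using \<open>T > 0\<close> by (simp_all add: field_simps)
  then show ?thesis
    by (intro that[of "s - of_int k * T"]) (simp_all only: minus_of_int, simp_all add: algebra_simps)
qed

lemma periodic_attains_sup:
  fixes f :: "real \<Rightarrow> real"
  assumes "periodic_fun_simple f T" "T > 0" "continuous_on UNIV f"
  obtains t where "\<And>s. f s \<le> f t"
proof -
  have "continuous_on {0..T} f" using assms(3) continuous_on_subset by blast
  then obtain t where t: "\<And>s. s \<in> {0..T} \<Longrightarrow> f s \<le> f t"
    using continuous_attains_sup[of "{0..T}" f] assms(2) by fastforce
  show ?thesis
  proof (rule that)
    fix s
    obtain s' where "0 \<le> s'" "s' \<le> 0 + T" "f s' = f s"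
      using periodic_representative[OF assms(1,2)] by blast
    then show "f s \<le> f t" using t[of s'] by simp
  qed
qed

lemma periodic_attains_inf:
  fixes f :: "real \<Rightarrow> real"
  assumes "periodic_fun_simple f T" "T > 0" "continuous_on UNIV f"
  obtains t where "\<And>s. f t \<le> f s"
proof -
  interpret periodic_fun_simple f T by fact
  have "periodic_fun_simple (\<lambda>t. - f t) T" by standard (simp add: plus_period)
  then obtain t where "\<And>s. - f s \<le> - f t"
    using periodic_attains_sup[of "\<lambda>t. - f t" T] assms(2,3) by (metis continuous_on_minus)
  then show ?thesis using that by auto
qed

lemma periodic_bounded:
  fixes f :: "real \<Rightarrow> real"
  assumes "periodic_fun_simple f T" "T > 0" "continuous_on UNIV f"
  obtains B where "\<And>s. \<bar>f s\<bar> \<le> B"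
proof -
  obtain t where t: "\<And>s. f s \<le> f t" using periodic_attains_sup[OF assms] by blast
  obtain u where u: "\<And>s. f u \<le> f s" using periodic_attains_inf[OF assms] by blast
  show ?thesis
  proof (rule that)
    show "\<bar>f s\<bar> \<le> max (f t) (- f u)" for s using t[of s] u[of s] by linarith
  qed
qed

lemma continuous_on_of_deriv:
  assumes "\<And>t. (y has_real_derivative D t) (at t)"
  shows "continuous_on S y"
  using assms DERIV_isCont by (blast intro: continuous_at_imp_continuous_on)

lemma periodic_critical_sup:
  assumes "periodic_fun_simple y T" "T > 0" and D: "\<And>t. (y has_real_derivative D t) (at t)"
  obtains t where "D t = 0" "\<And>s. y s \<le> y t"
proof -
  obtain t where t: "\<And>s. y s \<le> y t"
    using periodic_attains_sup[OF assms(1,2) continuous_on_of_deriv[OF D]] by blast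
  moreover have "D t = 0" using DERIV_local_max[OF D, of 1 t] t by simp
  ultimately show ?thesis using that by blast
qed

lemma periodic_critical_inf:
  assumes "periodic_fun_simple y T" "T > 0" and D: "\<And>t. (y has_real_derivative D t) (at t)"
  obtains t where "D t = 0" "\<And>s. y t \<le> y s"
proof -
  obtain t where t: "\<And>s. y t \<le> y s"
    using periodic_attains_inf[OF assms(1,2) continuous_on_of_deriv[OF D]] by blast
  moreover have "D t = 0" using DERIV_local_min[OF D, of 1 t] t by simp
  ultimately show ?thesis using that by blast
qed

lemma has_antiderivative_UNIV:
  fixes f :: "real \<Rightarrow> real"
  assumes "continuous_on UNIV f"
  obtains F where "\<And>t. (F has_real_derivative f t) (at t)"
proof -
  have "isCont f x" for x using assms continuous_on_eq_continuous_at[of UNIV f] by simp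
  then have "\<exists>F. \<forall>x. - \<infinity> < ereal x \<longrightarrow> ereal x < \<infinity> \<longrightarrow> (F has_vector_derivative f x) (at x)"
    by (intro einterval_antiderivative) auto
  then show ?thesis
    using that by (auto simp: has_real_derivative_iff_has_vector_derivative)
qed

text \<open>Variation of constants: with \<open>q = exp (- \<sigma> * T)\<close>, the solution is
  \<open>exp (\<sigma> * t)\<close> times the integral of \<open>exp (- \<sigma> * s) * h s\<close>
  over \<open>[t, t + T]\<close>, divided by \<open>q - 1\<close>. The divisor is nonzero because
  \<open>\<sigma> \<noteq> 0\<close> and \<open>T > 0\<close>.\<close>

lemma linear_ode_periodic_solution:
  fixes h :: "real \<Rightarrow> real"
  assumes "\<sigma> \<noteq> 0" "T > 0" and per: "periodic_fun_simple h T" and cont: "continuous_on UNIV h"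
  obtains y where "periodic_fun_simple y T" "\<And>t. (y has_real_derivative \<sigma> * y t + h t) (at t)"
proof -
  have "continuous_on UNIV (\<lambda>s. exp (- \<sigma> * s) * h s)" by (intro continuous_intros cont)
  then obtain F where F: "\<And>t. (F has_real_derivative exp (- \<sigma> * t) * h t) (at t)"
    using has_antiderivative_UNIV by blast
  have h: "h (t + T) = h t" for t using per by (rule periodic_fun_simple.plus_period)
  define q where "q = exp (- \<sigma> * T)"
  have q: "q \<noteq> 1" using assms(1,2) by (simp add: q_def)
  have FT: "((\<lambda>t. F (t + T)) has_real_derivative q * exp (- \<sigma> * t) * h t) (at t)" for t
  proof -
    have "exp (- \<sigma> * (t + T)) * h (t + T) = q * exp (- \<sigma> * t) * h t"
      unfolding h by (simp add: q_def exp_add[symmetric] algebra_simps)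
    then show ?thesis using F[of "t + T"] by (simp only: DERIV_shift)
  qed
  have "((\<lambda>t. F (t + T) - q * F t) has_real_derivative 0) (at t)" for t
    by (rule derivative_eq_intros FT F refl | simp)+
  \<comment> \<open>Consequently the increments of \<open>F\<close> over successive periods scale by
    \<open>q\<close>, which is what makes \<open>y\<close> periodic.\<close>
  then have const: "F (t + T) - q * F t = F (s + T) - q * F s" for s t
    using DERIV_isconst_all by blast
  define y where "y t = exp (\<sigma> * t) * (F (t + T) - F t) / (q - 1)" for t
  show ?thesis
  proof (rule that)
    show "periodic_fun_simple y T"
    proof
      fix t
      have "F (t + T + T) - F (t + T) = q * (F (t + T) - F t)"
        using const[of "t + T" t] by (simp add: algebra_simps)
      moreover have "exp (\<sigma> * (t + T)) * q = exp (\<sigma> * t)"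
        by (simp add: q_def exp_add[symmetric] algebra_simps)
      ultimately show "y (t + T) = y t"
        unfolding y_def by (metis mult.assoc)
    qed
    show "(y has_real_derivative \<sigma> * y t + h t) (at t)" for t
    proof -
      have "exp (\<sigma> * t) * exp (- \<sigma> * t) = 1" by (simp add: exp_add[symmetric])
      then have e: "exp (\<sigma> * t) * (q * exp (- \<sigma> * t) * h t - exp (- \<sigma> * t) * h t) = (q - 1) * h t"
        by algebra
      have "(y has_real_derivative (\<sigma> * exp (\<sigma> * t) * (F (t + T) - F t) +
          exp (\<sigma> * t) * (q * exp (- \<sigma> * t) * h t - exp (- \<sigma> * t) * h t)) / (q - 1)) (at t)"
        unfolding y_def by (rule derivative_eq_intros FT F refl | simp add: q)+
      then show ?thesis unfolding e using q by (simp add: y_def add_divide_distrib mult.assoc)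
    qed
  qed
qed

text \<open>At a maximum and at a minimum of \<open>y\<close> the derivative vanishes, so
  \<open>y\<close> and \<open>h\<close> have equal modulus there for either sign of
  \<open>\<sigma>\<close>. Applied to one solution this is an a priori bound; applied to a
  difference it gives continuous dependence on \<open>h\<close>.\<close>

lemma linear_ode_periodic_bound:
  assumes "\<bar>\<sigma>\<bar> = 1" "T > 0" "periodic_fun_simple y T"
    and y: "\<And>t. (y has_real_derivative \<sigma> * y t + h t) (at t)" and h: "\<And>t. \<bar>h t\<bar> \<le> B"
  shows "\<bar>y t\<bar> \<le> B"
proof -
  obtain u where u: "\<sigma> * y u + h u = 0" "\<And>s. y s \<le> y u"
    using periodic_critical_sup[OF assms(3,2) y] by blast
  obtain v where v: "\<sigma> * y v + h v = 0" "\<And>s. y v \<le> y s"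
    using periodic_critical_inf[OF assms(3,2) y] by blast
  have "\<sigma> = 1 \<or> \<sigma> = - 1" using assms(1) by linarith
  then have "\<bar>y u\<bar> = \<bar>h u\<bar>" "\<bar>y v\<bar> = \<bar>h v\<bar>" using u(1) v(1) by auto
  then show ?thesis using h[of u] h[of v] u(2)[of t] v(2)[of t] by linarith
qed

section \<open>Clamped values and their oscillation\<close>

definition clamp_real :: "real \<Rightarrow> real \<Rightarrow> real \<Rightarrow> real" where
  "clamp_real c d x = max c (min d x)"

lemma clamp_real_mem: "c \<le> d \<Longrightarrow> c \<le> clamp_real c d x \<and> clamp_real c d x \<le> d"
  by (auto simp: clamp_real_def)

lemma clamp_real_nonexpansive: "\<bar>clamp_real c d x - clamp_real c d y\<bar> \<le> \<bar>x - y\<bar>"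
  unfolding clamp_real_def by linarith

lemma integral_periodic_shift:
  fixes b :: "real \<Rightarrow> real"
  assumes "T > 0" "periodic_fun_simple b T"
    and B: "\<And>t. (B has_real_derivative b t) (at t)"
  shows "B (t + T) - B t = integral {0..T} b"
proof -
  have b: "b (t + T) = b t" for t using assms(2) by (rule periodic_fun_simple.plus_period)
  have BT: "((\<lambda>t. B (t + T)) has_real_derivative b t) (at t)" for t
    using B[of "t + T"] by (simp add: DERIV_shift b)
  have "((\<lambda>t. B (t + T) - B t) has_real_derivative 0) (at t)" for t
    by (rule derivative_eq_intros BT B refl | simp)+
  then have "B (t + T) - B t = B (0 + T) - B 0" using DERIV_isconst_all by blast
  moreover have "(b has_integral B T - B 0) {0..T}"
    using assms(1) B by (intro fundamental_theorem_of_calculus)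
      (auto simp: has_real_derivative_iff_has_vector_derivative intro: has_vector_derivative_at_within)
  ultimately show ?thesis by (simp add: integral_unique)
qed

text \<open>Only the derivative inside the strip matters: between a last visit to the higher clamped
  value and a first visit to the lower one the function stays in the strip.\<close>

lemma clamp_oscillation:
  assumes "T > 0" "c \<le> d" and y_per: "periodic_fun_simple y T"
    and y: "\<And>t. (y has_real_derivative D t) (at t)"
    and b_per: "periodic_fun_simple b T" and b: "continuous_on UNIV b" "\<And>t. 0 \<le> b t"
    and low: "\<And>t. c < y t \<Longrightarrow> y t < d \<Longrightarrow> - b t \<le> D t"
  shows "clamp_real c d (y t) \<le> clamp_real c d (y s) + integral {0..T} b"
proof -
  \<comment> \<open>A lower bound on the derivative limits descents only, so \<open>s\<close> is
    replaced by an equivalent point to the right of \<open>t\<close>, at most one period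
    away.\<close>
  obtain s' where s': "t \<le> s'" "s' \<le> t + T" "y s' = y s"
    using periodic_representative[OF y_per \<open>T > 0\<close>] by blast
  obtain B where B: "\<And>t. (B has_real_derivative b t) (at t)"
    using has_antiderivative_UNIV[OF b(1)] by blast
  have B_mono: "B p \<le> B q" if "p \<le> q" for p q
    by (rule DERIV_nonneg_imp_nondecreasing[OF that]) (use B b in blast)
  define C where "C = integral {0..T} b"
  have C: "B (u + T) - B u = C" for u
    unfolding C_def by (rule integral_periodic_shift[OF \<open>T > 0\<close> b_per B])
  have "0 \<le> C" using C[of 0] B_mono[of 0 "0 + T"] \<open>T > 0\<close> by simp
  define p q where "p = clamp_real c d (y t)" and "q = clamp_real c d (y s')"
  have cont: "continuous_on A y" for A using continuous_on_of_deriv[OF y] .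
  have "p \<le> q + C"
  proof (cases "p \<le> q")
    case False
    then have pq: "p \<le> y t" "y s' \<le> q" "c \<le> q" "q < p" "p \<le> d"
      using \<open>c \<le> d\<close> unfolding p_def q_def clamp_real_def by linarith+
    have compact: "compact ({a..b} \<inter> y -` A)" if "closed A" for a b A
      by (intro compact_Int_closed closed_vimage that cont compact_Icc)
    obtain v where v: "v \<in> {t..s'} \<inter> y -` {..q}" "\<And>x. x \<in> {t..s'} \<inter> y -` {..q} \<Longrightarrow> v \<le> x"
      using compact_attains_inf[OF compact[of "{..q}" t s']] pq s'(1) by fastforce
    obtain u where u: "u \<in> {t..v} \<inter> y -` {p..}" "\<And>x. x \<in> {t..v} \<inter> y -` {p..} \<Longrightarrow> x \<le> u"
      using compact_attains_sup[OF compact[of "{p..}" t v]] pq v(1) by fastforce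
    have strip: "q < y x \<and> y x < p" if "u < x" "x < v" for x
      using that u(1) v(1) u(2)[of x] v(2)[of x] by force
    \<comment> \<open>Since \<open>B\<close> is an antiderivative of \<open>b\<close>, the descent
      from \<open>u\<close> to \<open>v\<close> is at most \<open>B v - B u\<close>, and
      \<open>[u, v]\<close> lies within the single period \<open>[t, t + T]\<close>.\<close>
    have "y u + B u \<le> y v + B v"
    proof (rule DERIV_nonneg_imp_increasing_open[where f = "\<lambda>x. y x + B x"])
      fix x assume "u < x" "x < v"
      then have "0 \<le> D x + b x" using strip[of x] low[of x] pq by fastforce
      moreover have "((\<lambda>x. y x + B x) has_real_derivative D x + b x) (at x)"
        by (intro DERIV_add y B)
      ultimately show "\<exists>z. ((\<lambda>x. y x + B x) has_real_derivative z) (at x) \<and> 0 \<le> z" by blast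
    qed (use u in \<open>auto intro!: continuous_intros cont continuous_on_of_deriv[OF B]\<close>)
    moreover have "B v - B u \<le> B (t + T) - B t"
      using B_mono[of v "t + T"] B_mono[of t u] u(1) v(1) s' by force
    ultimately show ?thesis using u(1) v(1) C[of t] by force
  qed (use \<open>0 \<le> C\<close> in linarith)
  then show ?thesis by (simp add: p_def q_def C_def s')
qed

section \<open>Periodic solutions between barriers\<close>

text \<open>The compact convex set for Schauder's theorem. Its elements are bounded continuous
  functions on the whole line, which form a normed space under the supremum norm; periodicity is a
  closed linear condition there.\<close>

definition lipschitz_periodic :: "real \<Rightarrow> real \<Rightarrow> real \<Rightarrow> (real \<Rightarrow>\<^sub>C real) set" where
  "lipschitz_periodic T R K =
     {y. periodic_fun_simple (apply_bcontfun y) T \<and> (\<forall>t. \<bar>y t\<bar> \<le> R) \<and> (\<forall>s t. \<bar>y s - y t\<bar> \<le> K * \<bar>s - t\<bar>)}"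

lemma convex_lipschitz_periodic: "convex (lipschitz_periodic T R K)"
proof (rule convexI)
  fix x y :: "real \<Rightarrow>\<^sub>C real" and u v :: real
  assume x: "x \<in> lipschitz_periodic T R K" and y: "y \<in> lipschitz_periodic T R K"
    and uv: "0 \<le> u" "0 \<le> v" "u + v = 1"
  have comb: "\<bar>u * p + v * q\<bar> \<le> r" if "\<bar>p\<bar> \<le> r" "\<bar>q\<bar> \<le> r" for p q r
  proof -
    have "\<bar>u * p + v * q\<bar> \<le> u * \<bar>p\<bar> + v * \<bar>q\<bar>"
      using uv by (intro order_trans[OF abs_triangle_ineq]) (simp add: abs_mult)
    also have "\<dots> \<le> r" by (rule convex_bound_le) (use that uv in auto)
    finally show ?thesis .
  qed
  have "periodic_fun_simple (\<lambda>t. u * x t + v * y t) T"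
    using x y by (simp add: lipschitz_periodic_def periodic_fun_simple_def)
  moreover have "\<bar>u * x t + v * y t\<bar> \<le> R" for t
    using x y by (intro comb) (auto simp: lipschitz_periodic_def)
  moreover have "\<bar>u * x s + v * y s - (u * x t + v * y t)\<bar> \<le> K * \<bar>s - t\<bar>" for s t
  proof -
    have "\<bar>u * (x s - x t) + v * (y s - y t)\<bar> \<le> K * \<bar>s - t\<bar>"
      using x y by (intro comb) (auto simp: lipschitz_periodic_def)
    then show ?thesis by (simp add: algebra_simps)
  qed
  ultimately show "u *\<^sub>R x + v *\<^sub>R y \<in> lipschitz_periodic T R K"
    by (simp add: lipschitz_periodic_def plus_bcontfun.rep_eq scaleR_bcontfun.rep_eq)
qed

text \<open>Arzela-Ascoli on one period gives a uniformly convergent subsequence, and periodicity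
  carries the estimates to the whole line. The three defining conditions are pointwise and pass to
  the limit.\<close>

lemma compact_lipschitz_periodic:
  assumes "T > 0"
  shows "compact (lipschitz_periodic T R K)"
  unfolding compact_eq_seq_compact_metric
proof (rule seq_compactI)
  fix f :: "nat \<Rightarrow> real \<Rightarrow>\<^sub>C real"
  assume "\<forall>n. f n \<in> lipschitz_periodic T R K"
  then have f: "periodic_fun_simple (f n) T" "\<bar>f n t\<bar> \<le> R" "\<bar>f n s - f n t\<bar> \<le> K * \<bar>s - t\<bar>" for n s t
    by (auto simp: lipschitz_periodic_def)
  have "0 \<le> K" using f(3)[of 0 1 0] by simp
  obtain g k where k: "strict_mono (k :: nat \<Rightarrow> nat)"
    and g: "\<And>e. 0 < e \<Longrightarrow> \<exists>N. \<forall>n x. N \<le> n \<and> x \<in> {0..T} \<longrightarrow> norm (f (k n) x - g x) < e"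
  proof (rule Arzela_Ascoli[of "{0..T}" "\<lambda>n. apply_bcontfun (f n)" R])
    fix x e :: real assume "0 < e"
    show "\<exists>d>0. \<forall>n y. y \<in> {0..T} \<and> norm (x - y) < d \<longrightarrow> norm (f n x - f n y) < e"
    proof (intro exI[of _ "e / (K + 1)"] conjI allI impI)
      show "0 < e / (K + 1)" using \<open>0 < e\<close> \<open>0 \<le> K\<close> by simp
      fix n y assume "y \<in> {0..T} \<and> norm (x - y) < e / (K + 1)"
      then have "(K + 1) * \<bar>x - y\<bar> < e" using \<open>0 \<le> K\<close> by (simp add: field_simps)
      then show "norm (f n x - f n y) < e"
        using f(3)[of n x y] by (simp add: algebra_simps)
    qed
  qed (use f(2) in auto)
  have "Cauchy (f \<circ> k)"
  proof (rule metric_CauchyI)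
    fix e :: real assume "0 < e"
    then obtain N where N: "\<And>n x. N \<le> n \<Longrightarrow> x \<in> {0..T} \<Longrightarrow> \<bar>f (k n) x - g x\<bar> < e / 4"
      using g[of "e / 4"] by auto
    have "dist (f (k i)) (f (k j)) < e" if "N \<le> i" "N \<le> j" for i j
    proof -
      have "dist (f (k i) t) (f (k j) t) \<le> e / 2" for t
      proof -
        have "periodic_fun_simple (\<lambda>t. f (k i) t - f (k j) t) T"
          using f(1) by (simp add: periodic_fun_simple_def)
        then obtain t' where "0 \<le> t'" "t' \<le> 0 + T"
          "f (k i) t' - f (k j) t' = f (k i) t - f (k j) t"
          using periodic_representative[OF _ \<open>T > 0\<close>, of "\<lambda>t. f (k i) t - f (k j) t"] by blast
        moreover have "\<bar>f (k i) t' - g t'\<bar> < e / 4" "\<bar>f (k j) t' - g t'\<bar> < e / 4"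
          using N that \<open>0 \<le> t'\<close> \<open>t' \<le> 0 + T\<close> by auto
        ultimately show ?thesis unfolding dist_real_def by linarith
      qed
      then have "dist (f (k i)) (f (k j)) \<le> e / 2" by (rule dist_bound)
      then show ?thesis using \<open>0 < e\<close> by simp
    qed
    then show "\<exists>M. \<forall>m\<ge>M. \<forall>n\<ge>M. dist ((f \<circ> k) m) ((f \<circ> k) n) < e" by auto
  qed
  then obtain l where l: "(f \<circ> k) \<longlonglongrightarrow> l" using Cauchy_convergent_iff convergent_def by blast
  have pt: "(\<lambda>n. f (k n) t) \<longlonglongrightarrow> l t" for t
    using tendsto_uniform_limitI[OF tendsto_bcontfun_uniform_limit[OF l], of t] by (simp add: o_def)
  have "l (t + T) = l t" for t
    using pt[of "t + T"] f(1) LIMSEQ_unique[OF _ pt[of t]] by (simp add: periodic_fun_simple.plus_period)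
  moreover have "\<bar>l t\<bar> \<le> R" for t
    by (rule LIMSEQ_le_const2[OF tendsto_rabs[OF pt]]) (use f(2) in auto)
  moreover have "\<bar>l s - l t\<bar> \<le> K * \<bar>s - t\<bar>" for s t
    by (rule LIMSEQ_le_const2[OF tendsto_rabs[OF tendsto_diff[OF pt pt]]]) (use f(3) in auto)
  ultimately have "l \<in> lipschitz_periodic T R K"
    by (simp add: lipschitz_periodic_def periodic_fun_simple_def)
  with k l show "\<exists>l\<in>lipschitz_periodic T R K. \<exists>r. strict_mono r \<and> (f \<circ> r) \<longlonglongrightarrow> l" by blast
qed

definition strip :: "real \<Rightarrow> real \<Rightarrow> real \<Rightarrow> (real \<Rightarrow> real) set" where
  "strip T c d = {u. continuous_on UNIV u \<and> periodic_fun_simple u T \<and> (\<forall>t. c \<le> u t \<and> u t \<le> d)}"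

text \<open>The barriers are tested on the clamped function, whose oscillation is controlled even
  while the solution itself might leave the strip. If it rose beyond \<open>d\<close>, the modified
  equation at its maximum would give \<open>\<sigma> * G = d - y < 0\<close>, against
  \<open>barrier_d\<close>; likewise below \<open>c\<close>. Hence the clamp acts trivially on the
  solution.\<close>

theorem periodic_solution_between_barriers:
  fixes G :: "(real \<Rightarrow> real) \<Rightarrow> real \<Rightarrow> real"
  assumes "T > 0" "c \<le> d" and \<sigma>: "\<bar>\<sigma>\<bar> = 1"
    and b: "periodic_fun_simple b T" "continuous_on UNIV b" "\<And>t. 0 \<le> b t"
    and G_cont: "\<And>u. u \<in> strip T c d \<Longrightarrow> continuous_on UNIV (G u)"
    and G_per: "\<And>u. u \<in> strip T c d \<Longrightarrow> periodic_fun_simple (G u) T"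
    and G_bd: "\<And>u t. u \<in> strip T c d \<Longrightarrow> \<bar>G u t\<bar> \<le> B"
    and G_ulim: "\<And>U u. (\<And>n. U n \<in> strip T c d) \<Longrightarrow> u \<in> strip T c d \<Longrightarrow>
      uniform_limit UNIV U u sequentially \<Longrightarrow>
      uniform_limit UNIV (\<lambda>n. G (U n)) (G u) sequentially"
    and G_low: "\<And>u t. u \<in> strip T c d \<Longrightarrow> - b t \<le> G u t"
    and barrier_c: "\<And>u t. u \<in> strip T c d \<Longrightarrow>
      (\<And>s t. u s \<le> u t + integral {0..T} b) \<Longrightarrow> u t = c \<Longrightarrow> \<sigma> * G u t \<le> 0"
    and barrier_d: "\<And>u t. u \<in> strip T c d \<Longrightarrow>
      (\<And>s t. u s \<le> u t + integral {0..T} b) \<Longrightarrow> u t = d \<Longrightarrow> 0 \<le> \<sigma> * G u t"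
  obtains y where "y \<in> strip T c d" "\<And>s t. y s \<le> y t + integral {0..T} b"
    "\<And>t. (y has_real_derivative G y t) (at t)"
proof -
  define P where "P y = (\<lambda>t. clamp_real c d (y t))" for y :: "real \<Rightarrow> real"
  \<comment> \<open>The modified equation reads \<open>y' = \<sigma> * y + h y\<close>, where the
    forcing depends on \<open>y\<close> through \<open>P y\<close> only. The fixed point map solves
    the linear equation with the forcing frozen.\<close>
  define h where "h y t = G (P y) t - \<sigma> * P y t" for y t
  \<comment> \<open>\<open>R\<close> bounds the forcing, hence the periodic solution of the linear
    equation; the derivative of that solution is then at most \<open>2 * R\<close> in modulus, which
    gives the Lipschitz constant.\<close>
  define R where "R = B + max \<bar>c\<bar> \<bar>d\<bar>"
  define S where "S = lipschitz_periodic T R (2 * R)"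
  have P_cont: "continuous_on UNIV (P y)" if "continuous_on UNIV y" for y
    unfolding P_def clamp_real_def by (intro continuous_intros that)
  have P_strip: "P y \<in> strip T c d" if "continuous_on UNIV y" "periodic_fun_simple y T" for y
    using P_cont[OF that(1)] clamp_real_mem[OF \<open>c \<le> d\<close>] that(2)
    by (simp add: strip_def P_def periodic_fun_simple_def)
  have S_strip: "P (apply_bcontfun y) \<in> strip T c d" if "y \<in> S" for y
    using that by (intro P_strip) (auto simp: S_def lipschitz_periodic_def)
  have h_bd: "\<bar>h y t\<bar> \<le> R" if "P y \<in> strip T c d" for y t
  proof -
    have "\<bar>\<sigma> * P y t\<bar> \<le> max \<bar>c\<bar> \<bar>d\<bar>"
      using that \<sigma> by (auto simp: strip_def abs_mult dest: spec[of _ t])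
    then show ?thesis using G_bd[OF that, of t] unfolding h_def R_def by linarith
  qed
  have "\<exists>z\<in>S. \<forall>t. (z has_real_derivative \<sigma> * z t + h y t) (at t)" if "y \<in> S" for y
  proof -
    note st = S_strip[OF that]
    have "periodic_fun_simple (h y) T"
      using G_per[OF st] st by (simp add: h_def strip_def periodic_fun_simple_def)
    moreover have "continuous_on UNIV (h y)"
      unfolding h_def using G_cont[OF st] st by (auto simp: strip_def intro!: continuous_intros)
    ultimately obtain z where z: "periodic_fun_simple z T"
      "\<And>t. (z has_real_derivative \<sigma> * z t + h y t) (at t)"
      using linear_ode_periodic_solution[of \<sigma> T "h y"] \<sigma> \<open>T > 0\<close> by (metis abs_zero zero_neq_one)
    have z_bd: "\<bar>z t\<bar> \<le> R" for t
      by (rule linear_ode_periodic_bound[OF \<sigma> \<open>T > 0\<close> z h_bd[OF st]])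
    have "\<bar>\<sigma> * z t + h y t\<bar> \<le> 2 * R" for t
      using z_bd[of t] h_bd[OF st, of t] \<sigma> abs_triangle_ineq[of "\<sigma> * z t" "h y t"]
      by (simp add: abs_mult)
    then have z_lip: "\<bar>z s - z t\<bar> \<le> 2 * R * \<bar>s - t\<bar>" for s t
      using field_differentiable_bound[of UNIV z "\<lambda>t. \<sigma> * z t + h y t" "2 * R" s t] z(2) by simp
    have "z \<in> bcontfun"
      by (rule bcontfun_normI[of _ R]) (use z_bd continuous_on_of_deriv[OF z(2)] in auto)
    then obtain Z where "z = apply_bcontfun Z" by (metis Bcontfun_inverse)
    with z z_bd z_lip show ?thesis by (auto simp: S_def lipschitz_periodic_def)
  qed
  then obtain \<Phi> where \<Phi>: "\<And>y. y \<in> S \<Longrightarrow> \<Phi> y \<in> S"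
    "\<And>y t. y \<in> S \<Longrightarrow> (\<Phi> y has_real_derivative \<sigma> * \<Phi> y t + h y t) (at t)"
    by metis
  have "continuous_on S \<Phi>"
    unfolding continuous_on_sequentially
  proof (intro allI ballI impI, elim conjE)
    fix X x assume x: "x \<in> S" and X: "\<forall>n. X n \<in> S" and "X \<longlonglongrightarrow> x"
    then have lim: "uniform_limit UNIV (\<lambda>n. apply_bcontfun (X n)) x sequentially"
      by (intro tendsto_bcontfun_uniform_limit)
    have limP: "uniform_limit UNIV (\<lambda>n. P (X n)) (P x) sequentially"
    proof (rule uniform_limitI)
      fix e :: real assume "0 < e"
      from uniform_limitD[OF lim this]
      show "\<forall>\<^sub>F n in sequentially. \<forall>t\<in>UNIV. dist (P (X n) t) (P x t) < e"
        by eventually_elim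
          (auto simp: P_def dist_real_def intro: le_less_trans[OF clamp_real_nonexpansive])
    qed
    have limG: "uniform_limit UNIV (\<lambda>n. G (P (X n))) (G (P x)) sequentially"
      by (rule G_ulim[OF _ _ limP]) (use S_strip X x in auto)
    have "uniform_limit UNIV (\<lambda>n t. \<sigma> * P (X n) t) (\<lambda>t. \<sigma> * P x t) sequentially"
      by (rule bounded_linear.uniform_limit[OF bounded_linear_mult_right limP])
    then have limh: "uniform_limit UNIV (\<lambda>n. h (X n)) (h x) sequentially"
      unfolding h_def by (intro uniform_limit_minus limG)
    \<comment> \<open>The difference of two values of \<open>\<Phi>\<close> solves the linear
      equation forced by the difference of the forcings, so the periodic bound makes the values as
      close as the forcings are.\<close>
    have "uniform_limit UNIV (\<lambda>n. apply_bcontfun (\<Phi> (X n))) (\<Phi> x) sequentially"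
    proof (rule uniform_limitI)
      fix e :: real assume "0 < e"
      then have "0 < e / 2" by simp
      from uniform_limitD[OF limh this]
      show "\<forall>\<^sub>F n in sequentially. \<forall>t\<in>UNIV. dist (\<Phi> (X n) t) (\<Phi> x t) < e"
      proof eventually_elim
        case (elim n)
        have le: "\<bar>\<Phi> (X n) t - \<Phi> x t\<bar> \<le> e / 2" for t
        proof (rule linear_ode_periodic_bound[OF \<sigma> \<open>T > 0\<close>,
              where y = "\<lambda>t. \<Phi> (X n) t - \<Phi> x t" and h = "\<lambda>t. h (X n) t - h x t"])
          show "periodic_fun_simple (\<lambda>t. \<Phi> (X n) t - \<Phi> x t) T"
            using \<Phi>(1) X x by (simp add: S_def lipschitz_periodic_def periodic_fun_simple_def)
          show "((\<lambda>t. \<Phi> (X n) t - \<Phi> x t) has_real_derivative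
              \<sigma> * (\<Phi> (X n) t - \<Phi> x t) + (h (X n) t - h x t)) (at t)" for t
            using DERIV_diff[OF \<Phi>(2)[of "X n" t] \<Phi>(2)[of x t]] X x by (simp add: algebra_simps)
          show "\<bar>h (X n) t - h x t\<bar> \<le> e / 2" for t
            using elim by (simp add: dist_real_def less_imp_le)
        qed
        have "\<bar>\<Phi> (X n) t - \<Phi> x t\<bar> < e" for t
          by (rule le_less_trans[OF le]) (use \<open>0 < e\<close> in simp)
        then show ?case by (simp add: dist_real_def)
      qed
    qed
    then show "(\<Phi> \<circ> X) \<longlonglongrightarrow> \<Phi> x"
      unfolding o_def by (rule uniform_limit_tendsto_bcontfun)
  qed
  \<comment> \<open>This makes \<open>S\<close> nonempty; \<open>0 \<le> R\<close> holds because
    \<open>R\<close> bounds an absolute value.\<close>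
  moreover have "0 \<in> S"
  proof -
    have "P (\<lambda>_. 0) \<in> strip T c d" by (rule P_strip) (auto simp: periodic_fun_simple_def)
    from h_bd[OF this, of 0] have "0 \<le> R" by linarith
    then show ?thesis by (simp add: S_def lipschitz_periodic_def periodic_fun_simple_def)
  qed
  ultimately obtain y where y: "y \<in> S" "\<Phi> y = y"
    using schauder_fixed_point[of S \<Phi>] \<Phi>(1) compact_lipschitz_periodic[OF \<open>T > 0\<close>]
      convex_lipschitz_periodic unfolding S_def by blast
  note st = S_strip[OF y(1)]
  have y_per: "periodic_fun_simple y T" using y(1) by (simp add: S_def lipschitz_periodic_def)
  have y': "(y has_real_derivative G (P y) t + \<sigma> * (y t - P y t)) (at t)" for t
    using \<Phi>(2)[OF y(1), of t] unfolding y(2) h_def by (simp add: algebra_simps)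
  \<comment> \<open>Strictly inside the strip the correction term vanishes, and \<open>G_low\<close>
    supplies the slope bound.\<close>
  have osc: "P y s \<le> P y t + integral {0..T} b" for s t
    unfolding P_def
  proof (rule clamp_oscillation[OF \<open>T > 0\<close> \<open>c \<le> d\<close> y_per y' b])
    fix t assume "c < y t" "y t < d"
    then have "P y t = y t" by (simp add: P_def clamp_real_def)
    then show "- b t \<le> G (P y) t + \<sigma> * (y t - P y t)" using G_low[OF st] by simp
  qed
  have \<sigma>2: "\<sigma> * \<sigma> = 1" using \<sigma> by (metis abs_mult_self_eq mult.right_neutral)
  \<comment> \<open>Multiplying by \<open>\<sigma>\<close> treats both signs at once: at a critical
    point \<open>\<sigma> * G\<close> is opposite to the overshoot \<open>y - P y\<close>.\<close>
  have crit: "\<sigma> * G (P y) t = P y t - y t" if "G (P y) t + \<sigma> * (y t - P y t) = 0" for t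
  proof -
    have "\<sigma> * (G (P y) t + \<sigma> * (y t - P y t)) = 0" using that by simp
    then show ?thesis using \<sigma>2 by algebra
  qed
  have "y t \<le> d" for t
  proof -
    obtain t0 where t0: "G (P y) t0 + \<sigma> * (y t0 - P y t0) = 0" "\<And>s. y s \<le> y t0"
      using periodic_critical_sup[OF y_per \<open>T > 0\<close> y'] by blast
    have "y t0 \<le> d"
    proof (rule ccontr)
      assume "\<not> y t0 \<le> d"
      moreover from this have "P y t0 = d" using \<open>c \<le> d\<close> by (simp add: P_def clamp_real_def)
      ultimately show False using barrier_d[OF st osc] crit[OF t0(1)] by force
    qed
    then show ?thesis using t0(2)[of t] by simp
  qed
  moreover have "c \<le> y t" for t
  proof -
    obtain t0 where t0: "G (P y) t0 + \<sigma> * (y t0 - P y t0) = 0" "\<And>s. y t0 \<le> y s"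
      using periodic_critical_inf[OF y_per \<open>T > 0\<close> y'] by blast
    have "c \<le> y t0"
    proof (rule ccontr)
      assume "\<not> c \<le> y t0"
      moreover from this have "P y t0 = c" using \<open>c \<le> d\<close> by (simp add: P_def clamp_real_def)
      ultimately show False using barrier_c[OF st osc] crit[OF t0(1)] by force
    qed
    then show ?thesis using t0(2)[of t] by simp
  qed
  ultimately have "P y = y" by (auto simp: P_def clamp_real_def)
  then show ?thesis using that[of y] st osc y' by simp
qed

section \<open>The delay equation\<close>

lemma uniform_limit_sum_fun:
  fixes f :: "'k \<Rightarrow> 'n \<Rightarrow> 'a \<Rightarrow> 'b::real_normed_vector"
  assumes "\<And>k. k \<in> K \<Longrightarrow> uniform_limit A (f k) (l k) F"
  shows "uniform_limit A (\<lambda>n t. \<Sum>k\<in>K. f k n t) (\<lambda>t. \<Sum>k\<in>K. l k t) F"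
  using assms
  by (induction K rule: infinite_finite_induct) (auto intro!: uniform_limit_add uniform_limit_const)

lemma dist_triple_le:
  fixes x y :: "real \<times> real \<times> real"
  shows "dist x y \<le> dist (fst x) (fst y) + dist (fst (snd x)) (fst (snd y))
    + dist (snd (snd x)) (snd (snd y))"
proof -
  have pair: "dist p q \<le> dist (fst p) (fst q) + dist (snd p) (snd q)"
    for p q :: "'a::metric_space \<times> 'b::metric_space"
    unfolding dist_prod_def by (rule sqrt_sum_squares_le_sum) auto
  show ?thesis using pair[of x y] pair[of "snd x" "snd y"] by linarith
qed

text \<open>All three arguments stay in a compact cube, where \<open>\<phi>\<close> is uniformly
  continuous; convergence that is uniform on the line covers the shifted times \<open>f t\<close>
  and \<open>g t\<close> as well.\<close>

lemma uniform_limit_delay: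
  fixes \<phi> :: "real \<times> real \<times> real \<Rightarrow> real"
  assumes \<phi>: "continuous_on ({c..d} \<times> {c..d} \<times> {c..d}) \<phi>"
    and U: "\<And>n t. U n t \<in> {c..d}" and u: "\<And>t. u t \<in> {c..d}"
    and R: "\<And>t. \<bar>\<rho> t\<bar> \<le> R" and lim: "uniform_limit UNIV U u sequentially"
  shows "uniform_limit UNIV (\<lambda>n t. \<rho> t * \<phi> (U n (f t), U n t, U n (g t)))
    (\<lambda>t. \<rho> t * \<phi> (u (f t), u t, u (g t))) sequentially"
proof (rule uniform_limitI)
  fix e :: real assume "0 < e"
  have "0 \<le> R" using order_trans[OF abs_ge_zero R] .
  have "compact ({c..d} \<times> {c..d} \<times> {c..d})" by (intro compact_Times compact_Icc)
  then have "uniformly_continuous_on ({c..d} \<times> {c..d} \<times> {c..d}) \<phi>"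
    by (rule compact_uniformly_continuous[OF \<phi>])
  moreover have "0 < e / (R + 1)" using \<open>0 < e\<close> \<open>0 \<le> R\<close> by simp
  ultimately obtain \<delta> where "0 < \<delta>" and \<delta>: "\<And>x y. x \<in> {c..d} \<times> {c..d} \<times> {c..d} \<Longrightarrow>
    y \<in> {c..d} \<times> {c..d} \<times> {c..d} \<Longrightarrow> dist x y < \<delta> \<Longrightarrow> dist (\<phi> x) (\<phi> y) < e / (R + 1)"
    unfolding uniformly_continuous_on_def by metis
  have "0 < \<delta> / 3" using \<open>0 < \<delta>\<close> by simp
  from uniform_limitD[OF lim this]
  show "\<forall>\<^sub>F n in sequentially. \<forall>t\<in>UNIV. dist (\<rho> t * \<phi> (U n (f t), U n t, U n (g t)))
      (\<rho> t * \<phi> (u (f t), u t, u (g t))) < e"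
  proof eventually_elim
    case (elim n)
    show ?case
    proof
      fix t
      let ?x = "(U n (f t), U n t, U n (g t))" and ?y = "(u (f t), u t, u (g t))"
      have "dist (U n (f t)) (u (f t)) < \<delta> / 3" "dist (U n t) (u t) < \<delta> / 3"
        "dist (U n (g t)) (u (g t)) < \<delta> / 3"
        using elim by auto
      then have "dist ?x ?y < \<delta>"
        using dist_triple_le[of ?x ?y] by simp
      then have less: "\<bar>\<phi> ?x - \<phi> ?y\<bar> < e / (R + 1)"
        using \<delta>[of ?x ?y] U u by (simp add: dist_real_def)
      have "dist (\<rho> t * \<phi> ?x) (\<rho> t * \<phi> ?y) = \<bar>\<rho> t\<bar> * \<bar>\<phi> ?x - \<phi> ?y\<bar>"
        by (simp add: dist_real_def abs_mult[symmetric] algebra_simps)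
      also have "\<dots> \<le> (R + 1) * \<bar>\<phi> ?x - \<phi> ?y\<bar>"
        using R[of t] by (intro mult_right_mono) auto
      also have "\<dots> < e" using less \<open>0 \<le> R\<close> by (simp add: field_simps)
      finally show "dist (\<rho> t * \<phi> ?x) (\<rho> t * \<phi> ?y) < e" .
    qed
  qed
qed

text \<open>The gap \<open>g\<close> in the limiting inequality is continuous and periodic, so it
  has a positive minimum, and a single range of \<open>\<gamma>\<close> serves all
  \<open>t\<close>.\<close>

lemma eventually_uniform_sum_less:
  fixes \<rho> :: "'k \<Rightarrow> real \<Rightarrow> real"
  assumes "finite I" "T > 0"
    and \<rho>: "\<And>k. k \<in> I \<Longrightarrow> continuous_on UNIV (\<rho> k) \<and> periodic_fun_simple (\<rho> k) T"
    and b: "continuous_on UNIV b" "periodic_fun_simple b T"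
    and a: "\<And>k. k \<in> I \<Longrightarrow> (a k \<longlongrightarrow> A k) F"
    and less: "\<And>t. (\<Sum>k\<in>I. \<rho> k t * A k) < b t"
  shows "\<forall>\<^sub>F \<gamma> in F. \<forall>t. (\<Sum>k\<in>I. \<rho> k t * a k \<gamma>) < b t"
proof -
  define g where "g t = b t - (\<Sum>k\<in>I. \<rho> k t * A k)" for t
  have "continuous_on UNIV g" unfolding g_def using \<rho> b by (intro continuous_intros) auto
  moreover have "periodic_fun_simple g T"
    using \<rho> b by (simp add: g_def periodic_fun_simple_def)
  ultimately obtain t0 where t0: "\<And>t. g t0 \<le> g t"
    using periodic_attains_inf \<open>T > 0\<close> by blast
  have "0 < g t0" using less by (simp add: g_def)
  have "\<exists>R. \<forall>t. \<bar>\<rho> k t\<bar> \<le> R" if "k \<in> I" for k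
    using periodic_bounded[of "\<rho> k" T] \<rho>[OF that] \<open>T > 0\<close> by metis
  then obtain R where R: "\<And>k t. k \<in> I \<Longrightarrow> \<bar>\<rho> k t\<bar> \<le> R k" by metis
  have "((\<lambda>\<gamma>. \<Sum>k\<in>I. R k * \<bar>a k \<gamma> - A k\<bar>) \<longlongrightarrow> (\<Sum>k\<in>I. R k * \<bar>A k - A k\<bar>)) F"
    by (intro tendsto_intros a)
  then have "\<forall>\<^sub>F \<gamma> in F. (\<Sum>k\<in>I. R k * \<bar>a k \<gamma> - A k\<bar>) < g t0"
    using \<open>0 < g t0\<close> by (intro order_tendstoD(2)[of _ 0]) simp_all
  then show ?thesis
  proof eventually_elim
    case (elim \<gamma>)
    show ?case
    proof
      fix t
      have "(\<Sum>k\<in>I. \<rho> k t * a k \<gamma>) \<le> (\<Sum>k\<in>I. \<rho> k t * A k + R k * \<bar>a k \<gamma> - A k\<bar>)"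
      proof (rule sum_mono)
        fix k assume "k \<in> I"
        have "\<rho> k t * (a k \<gamma> - A k) \<le> \<bar>\<rho> k t\<bar> * \<bar>a k \<gamma> - A k\<bar>"
          by (metis abs_ge_self abs_mult)
        also have "\<dots> \<le> R k * \<bar>a k \<gamma> - A k\<bar>"
          using R[OF \<open>k \<in> I\<close>] by (intro mult_right_mono) auto
        finally show "\<rho> k t * a k \<gamma> \<le> \<rho> k t * A k + R k * \<bar>a k \<gamma> - A k\<bar>"
          by (simp add: algebra_simps)
      qed
      also have "\<dots> < (\<Sum>k\<in>I. \<rho> k t * A k) + g t0"
        using elim by (simp add: sum.distrib)
      also have "\<dots> \<le> b t" using t0[of t] by (simp add: g_def)
      finally show "(\<Sum>k\<in>I. \<rho> k t * a k \<gamma>) < b t" .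
    qed
  qed
qed

section \<open>Limits of one summand of the field at very low and very high levels\<close>

lemma growth_quotient_at_bot_zero:
  assumes "m > 1" "n > (0::real)"
  shows "((\<lambda>\<gamma>. exp (m * (\<gamma> + C) - \<gamma>) / (1 + exp (n * (\<gamma> - C)))) \<longlongrightarrow> 0) at_bot"
proof -
  have "m - 1 > 0" using assms by simp
  then show ?thesis using assms by real_asymp
qed

lemma growth_quotient_at_bot_infinity:
  assumes "m < 1" "n > (0::real)"
  shows "(LIM \<gamma> at_bot. exp (m * (\<gamma> - C) - \<gamma>) / (1 + exp (n * (\<gamma> + C))) :> at_top)"
proof -
  have "m - 1 < 0" using assms by simp
  then show ?thesis using assms by real_asymp
qed

lemma growth_quotient_at_top_zero:
  assumes "m < n + 1"
  shows "((\<lambda>\<gamma>::real. exp (m * \<gamma> - \<gamma>) / (1 + exp (n * (\<gamma> - C)))) \<longlongrightarrow> 0) at_top"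
proof -
  \<comment> \<open>The exponential rate of the quotient once the 1 in the denominator is dropped;
    it is negative in the subcritical case.\<close>
  define e where "e = m - 1 - n"
  have "e < 0" using assms by (simp add: e_def)
  then have lim: "((\<lambda>\<gamma>::real. exp (e * \<gamma> + n * C)) \<longlongrightarrow> 0) at_top" by real_asymp
  have bound: "norm (exp (m * \<gamma> - \<gamma>) / (1 + exp (n * (\<gamma> - C)))) \<le> exp (e * \<gamma> + n * C)" for \<gamma>
  proof -
    have "exp (m * \<gamma> - \<gamma>) = exp (e * \<gamma> + n * C) * exp (n * (\<gamma> - C))"
      by (simp add: e_def exp_add[symmetric] algebra_simps)
    also have "\<dots> \<le> exp (e * \<gamma> + n * C) * (1 + exp (n * (\<gamma> - C)))" by simp
    finally show ?thesis by (simp add: divide_le_eq add_pos_pos)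
  qed
  show ?thesis by (rule Lim_null_comparison[OF _ lim]) (simp only: bound eventually_True)
qed

text \<open>In the critical case \<open>m = n + 1\<close> numerator and denominator grow at the same
  rate and a positive limit remains. Here and in the companion below it is the weight
  \<open>exp (C * n)\<close> or \<open>exp (- C * m)\<close> in the conditions on
  \<open>M4\<close>.\<close>

lemma growth_quotient_at_top_critical:
  assumes "n > (0::real)"
  shows "((\<lambda>\<gamma>. exp ((n + 1) * \<gamma> - \<gamma>) / (1 + exp (n * (\<gamma> - C)))) \<longlongrightarrow> exp (C * n)) at_top"
  using assms by real_asymp (simp add: exp_minus mult.commute)

lemma growth_quotient_at_top_critical':
  assumes "n > (0::real)"
  shows "((\<lambda>\<gamma>. exp ((n + 1) * (\<gamma> - C) - \<gamma>) / (1 + exp (n * \<gamma>))) \<longlongrightarrow> exp (- C * (n + 1))) at_top"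
  using assms by real_asymp (simp add: exp_minus[symmetric] mult.commute)

lemma has_at_least_2I: "a \<in> A \<Longrightarrow> b \<in> A \<Longrightarrow> a \<noteq> b \<Longrightarrow> has_at_least 2 A"
  unfolding has_at_least_def by (intro exI[of _ "{a, b}"]) auto

lemma has_at_least_3I:
  "a \<in> A \<Longrightarrow> b \<in> A \<Longrightarrow> c \<in> A \<Longrightarrow> a \<noteq> b \<Longrightarrow> a \<noteq> c \<Longrightarrow> b \<noteq> c \<Longrightarrow> has_at_least 3 A"
  unfolding has_at_least_def by (intro exI[of _ "{a, b, c}"]) auto

lemma below_at_bot:
  fixes \<gamma> :: real
  assumes "\<forall>\<^sub>F c in at_bot. P c"
  obtains c where "c < \<gamma>" "P c"
  using eventually_happens[OF eventually_conj[OF eventually_gt_at_bot[of \<gamma>] assms]] by auto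

lemma above_at_top:
  fixes \<gamma> :: real
  assumes "\<forall>\<^sub>F d in at_top. P d"
  obtains d where "\<gamma> < d" "P d"
  using eventually_happens[OF eventually_conj[OF eventually_gt_at_top[of \<gamma>] assms]] by auto

section \<open>Regularity and bounds of the field for the logarithm\<close>

locale delay_equation =
  fixes T :: real and M :: nat
    and lam m n :: "nat \<Rightarrow> real"
    and r \<tau> \<mu> :: "nat \<Rightarrow> real \<Rightarrow> real"
    and b :: "real \<Rightarrow> real"
  assumes T_pos: "T > 0"
    and coeff_pos: "k \<in> {1..M} \<Longrightarrow> lam k > 0 \<and> m k > 0 \<and> n k > 0"
    and delays: "k \<in> {1..M} \<Longrightarrow> continuous_positive_periodic T (r k) \<and>
           continuous_positive_periodic T (\<tau> k) \<and> continuous_positive_periodic T (\<mu> k)"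
    and decay: "continuous_positive_periodic T b"
begin

text \<open>The right-hand side of the equation for \<open>ln x\<close>.\<close>

definition G :: "(real \<Rightarrow> real) \<Rightarrow> real \<Rightarrow> real" where
  "G u t = (\<Sum>k=1..M. lam k * r k t *
     (exp (m k * u (t - \<tau> k t) - u t) / (1 + exp (n k * u (t - \<mu> k t))))) - b t"

abbreviation "C \<equiv> Cint T b"

lemma b_facts: "continuous_on UNIV b" "0 < b t" "periodic_fun_simple b T"
  using decay by (auto simp: continuous_positive_periodic_def)

lemma r_facts:
  assumes "k \<in> {1..M}"
  shows "continuous_on UNIV (r k)" "0 < r k t" "periodic_fun_simple (r k) T"
  using delays[OF assms] by (auto simp: continuous_positive_periodic_def)

lemma weight_pos: "k \<in> {1..M} \<Longrightarrow> 0 < lam k * r k t"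
  using coeff_pos r_facts by simp

lemma weight_periodic:
  assumes "k \<in> {1..M}"
  shows "continuous_on UNIV (\<lambda>t. lam k * r k t) \<and> periodic_fun_simple (\<lambda>t. lam k * r k t) T"
  using r_facts[OF assms] by (auto intro!: continuous_intros simp: periodic_fun_simple_def)

lemma one_plus_exp_pos: "0 < 1 + exp (x::real)"
  by (simp add: add_pos_pos)

lemma term_nonneg:
  assumes "k \<in> {1..M}"
  shows "0 \<le> lam k * r k t * (exp p / (1 + exp q))"
proof (rule mult_nonneg_nonneg)
  show "0 \<le> lam k * r k t" using weight_pos[OF assms, of t] by (rule less_imp_le)
  show "0 \<le> exp p / (1 + exp q)" using one_plus_exp_pos[of q] by simp
qed

lemma G_low: "- b t \<le> G u t"
proof -
  have "0 \<le> (\<Sum>k=1..M. lam k * r k t *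
      (exp (m k * u (t - \<tau> k t) - u t) / (1 + exp (n k * u (t - \<mu> k t)))))"
    by (rule sum_nonneg) (rule term_nonneg)
  then show ?thesis by (simp add: G_def)
qed

lemma G_continuous:
  assumes "continuous_on UNIV u"
  shows "continuous_on UNIV (G u)"
proof -
  have "continuous_on UNIV (\<lambda>t. u (t - \<delta> t))" if "continuous_on UNIV \<delta>" for \<delta>
    by (rule continuous_on_compose2[OF assms, of UNIV "\<lambda>t. t - \<delta> t"])
      (auto intro!: continuous_intros that)
  then show ?thesis
    unfolding G_def using assms delays b_facts one_plus_exp_pos
    by (intro continuous_intros)
      (auto simp: continuous_positive_periodic_def less_imp_neq[THEN not_sym])
qed

lemma G_periodic:
  assumes "periodic_fun_simple u T"
  shows "periodic_fun_simple (G u) T"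
proof
  fix t
  have u: "u (s + T) = u s" for s using assms by (rule periodic_fun_simple.plus_period)
  have shift: "u (t + T - s) = u (t - s)" for s using u[of "t - s"] by (simp add: algebra_simps)
  have "r k (t + T) = r k t" "\<tau> k (t + T) = \<tau> k t" "\<mu> k (t + T) = \<mu> k t" if "k \<in> {1..M}" for k
    using delays[OF that] by (auto simp: continuous_positive_periodic_def periodic_fun_simple_def)
  moreover have "b (t + T) = b t" using b_facts(3) by (rule periodic_fun_simple.plus_period)
  ultimately show "G u (t + T) = G u t" unfolding G_def by (simp add: u shift)
qed

text \<open>On the strip the numerators are at most \<open>exp (m k * d - c)\<close> and the
  denominators at least 1; from below the field is bounded by \<open>- b\<close>.\<close>

lemma G_bounded:
  obtains B where "\<And>u t. u \<in> strip T c d \<Longrightarrow> \<bar>G u t\<bar> \<le> B"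
proof -
  have "\<exists>R. \<forall>t. \<bar>lam k * r k t\<bar> \<le> R" if "k \<in> {1..M}" for k
    using periodic_bounded[of "\<lambda>t. lam k * r k t" T] weight_periodic[OF that] T_pos by metis
  then obtain R where R: "\<And>k t. k \<in> {1..M} \<Longrightarrow> \<bar>lam k * r k t\<bar> \<le> R k" by metis
  obtain Bb where Bb: "\<And>t. \<bar>b t\<bar> \<le> Bb"
    using periodic_bounded[OF b_facts(3) T_pos b_facts(1)] by blast
  show ?thesis
  proof (rule that)
    fix u t assume u: "u \<in> strip T c d"
    have "(\<Sum>k=1..M. lam k * r k t *
        (exp (m k * u (t - \<tau> k t) - u t) / (1 + exp (n k * u (t - \<mu> k t)))))
        \<le> (\<Sum>k=1..M. R k * exp (m k * d - c))"
    proof (intro sum_mono mult_mono)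
      fix k assume k: "k \<in> {1..M}"
      have "m k * u (t - \<tau> k t) \<le> m k * d" "c \<le> u t"
        using u coeff_pos[OF k] by (auto simp: strip_def)
      then have "exp (m k * u (t - \<tau> k t) - u t) / (1 + exp (n k * u (t - \<mu> k t)))
          \<le> exp (m k * d - c) / 1"
        by (intro frac_le) auto
      then show "exp (m k * u (t - \<tau> k t) - u t) / (1 + exp (n k * u (t - \<mu> k t)))
          \<le> exp (m k * d - c)" by simp
      show "lam k * r k t \<le> R k" "0 \<le> R k" using R[OF k, of t] by linarith+
      show "0 \<le> exp (m k * u (t - \<tau> k t) - u t) / (1 + exp (n k * u (t - \<mu> k t)))"
        by (simp add: less_imp_le one_plus_exp_pos)
    qed
    moreover have "- b t \<le> G u t" by (rule G_low)
    ultimately show "\<bar>G u t\<bar> \<le> \<bar>\<Sum>k=1..M. R k * exp (m k * d - c)\<bar> + Bb"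
      using Bb[of t] b_facts(2)[of t] unfolding G_def by linarith
  qed
qed

lemma G_uniform_limit:
  assumes U: "\<And>n. U n \<in> strip T c d" and u: "u \<in> strip T c d"
    and lim: "uniform_limit UNIV U u sequentially"
  shows "uniform_limit UNIV (\<lambda>n. G (U n)) (G u) sequentially"
  unfolding G_def
proof (intro uniform_limit_minus uniform_limit_sum_fun uniform_limit_const)
  fix k assume k: "k \<in> {1..M}"
  obtain R where R: "\<And>t. \<bar>lam k * r k t\<bar> \<le> R"
    using periodic_bounded[of "\<lambda>t. lam k * r k t" T] weight_periodic[OF k] T_pos by metis
  define \<phi> where "\<phi> z = exp (m k * fst z - fst (snd z)) / (1 + exp (n k * snd (snd z)))"
    for z :: "real \<times> real \<times> real"
  have \<phi>: "continuous_on ({c..d} \<times> {c..d} \<times> {c..d}) \<phi>"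
    unfolding \<phi>_def using one_plus_exp_pos
    by (intro continuous_intros) (auto simp: less_imp_neq[THEN not_sym])
  have "uniform_limit UNIV
      (\<lambda>i t. lam k * r k t * \<phi> (U i (t - \<tau> k t), U i t, U i (t - \<mu> k t)))
      (\<lambda>t. lam k * r k t * \<phi> (u (t - \<tau> k t), u t, u (t - \<mu> k t))) sequentially"
  proof (rule uniform_limit_delay[where \<rho> = "\<lambda>t. lam k * r k t" and U = U and u = u
        and f = "\<lambda>t. t - \<tau> k t" and g = "\<lambda>t. t - \<mu> k t", OF \<phi>])
    show "U i t \<in> {c..d}" "u t \<in> {c..d}" for i t using U u by (auto simp: strip_def)
  qed (use R lim in auto)
  then show "uniform_limit UNIV (\<lambda>i t. lam k * r k t * (exp (m k * U i (t - \<tau> k t) - U i t) /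
      (1 + exp (n k * U i (t - \<mu> k t))))) (\<lambda>t. lam k * r k t * (exp (m k * u (t - \<tau> k t) - u t) /
      (1 + exp (n k * u (t - \<mu> k t))))) sequentially"
    by (simp only: \<phi>_def fst_conv snd_conv)
qed

section \<open>Barrier levels and the solutions in strips\<close>

definition osc :: "(real \<Rightarrow> real) \<Rightarrow> bool" where
  "osc u \<longleftrightarrow> (\<forall>s t. u s \<le> u t + C)"

text \<open>The bound \<open>u \<le> d\<close> matters only at the top level \<open>\<gamma> = d\<close>, where it improves on
  \<open>u \<le> \<gamma> + C\<close>; this is why the hypotheses on \<open>M4\<close> suffice there.\<close>

definition rises :: "real \<Rightarrow> real \<Rightarrow> bool" where
  "rises d \<gamma> \<longleftrightarrow> (\<forall>u t. osc u \<longrightarrow> (\<forall>s. u s \<le> d) \<longrightarrow> u t = \<gamma> \<longrightarrow> 0 < G u t)"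

definition falls :: "real \<Rightarrow> real \<Rightarrow> bool" where
  "falls d \<gamma> \<longleftrightarrow> (\<forall>u t. osc u \<longrightarrow> (\<forall>s. u s \<le> d) \<longrightarrow> u t = \<gamma> \<longrightarrow> G u t < 0)"

text \<open>The oscillation bound is recorded so that \<open>rises\<close> and \<open>falls\<close>
  apply to a solution itself when two solutions are told apart.\<close>

definition log_solutions :: "real \<Rightarrow> real \<Rightarrow> (real \<Rightarrow> real) set" where
  "log_solutions c d = {y \<in> strip T c d. osc y \<and> (\<forall>t. (y has_real_derivative G y t) (at t))}"

lemma log_solution_exists:
  assumes "c \<le> d" "\<bar>\<sigma>\<bar> = 1"
    and "\<And>u t. u \<in> strip T c d \<Longrightarrow> osc u \<Longrightarrow> u t = c \<Longrightarrow> \<sigma> * G u t \<le> 0"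
    and "\<And>u t. u \<in> strip T c d \<Longrightarrow> osc u \<Longrightarrow> u t = d \<Longrightarrow> 0 \<le> \<sigma> * G u t"
  obtains y where "y \<in> log_solutions c d"
proof -
  obtain B where B: "\<And>u t. u \<in> strip T c d \<Longrightarrow> \<bar>G u t\<bar> \<le> B" using G_bounded by blast
  obtain y where "y \<in> strip T c d" "\<And>s t. y s \<le> y t + integral {0..T} b"
    "\<And>t. (y has_real_derivative G y t) (at t)"
  proof (rule periodic_solution_between_barriers[OF T_pos assms(1,2) b_facts(3,1), of G B])
    show "continuous_on UNIV (G u)" if "u \<in> strip T c d" for u
      using that G_continuous by (simp add: strip_def)
    show "periodic_fun_simple (G u) T" if "u \<in> strip T c d" for u
      using that G_periodic by (simp add: strip_def)
    show "uniform_limit UNIV (\<lambda>i. G (U i)) (G u) sequentially"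
      if "\<And>i. U i \<in> strip T c d" "u \<in> strip T c d" "uniform_limit UNIV U u sequentially" for U u
      using that by (rule G_uniform_limit)
  qed (use B G_low b_facts(2) assms(3,4) in
      \<open>auto simp: less_imp_le osc_def Cint_def\<close>)
  then show ?thesis using that by (auto simp: log_solutions_def osc_def Cint_def)
qed

lemma attracting_strip:
  assumes "c \<le> d" "rises d c" "falls d d"
  obtains y where "y \<in> log_solutions c d"
proof (rule log_solution_exists[OF assms(1), of "-1"])
  show "- 1 * G u t \<le> 0" if "u \<in> strip T c d" "osc u" "u t = c" for u t
    using that assms(2) by (fastforce simp: rises_def strip_def)
  show "0 \<le> - 1 * G u t" if "u \<in> strip T c d" "osc u" "u t = d" for u t
    using that assms(3) by (fastforce simp: falls_def strip_def)
qed (use that in auto)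

lemma repelling_strip:
  assumes "c \<le> d" "falls d c" "rises d d"
  obtains y where "y \<in> log_solutions c d"
proof (rule log_solution_exists[OF assms(1), of 1])
  show "1 * G u t \<le> 0" if "u \<in> strip T c d" "osc u" "u t = c" for u t
    using that assms(2) by (fastforce simp: falls_def strip_def)
  show "0 \<le> 1 * G u t" if "u \<in> strip T c d" "osc u" "u t = d" for u t
    using that assms(3) by (fastforce simp: rises_def strip_def)
qed (use that in auto)

lemma exp_log_solution:
  assumes "y \<in> log_solutions c d"
  shows "(\<lambda>t. exp (y t)) \<in> positive_periodic_solutions T M lam m n r \<tau> \<mu> b"
proof -
  have y: "(y has_real_derivative G y t) (at t)" "y (t + T) = y t" for t
    using assms by (auto simp: log_solutions_def strip_def periodic_fun_simple_def)
  \<comment> \<open>The factor \<open>exp (y t)\<close> cancels the current value subtracted in the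
    exponents of \<open>G\<close>, which restores the original right-hand side.\<close>
  have "exp (y t) * G y t = (\<Sum>k=1..M. lam k * r k t * (exp (y (t - \<tau> k t)) powr m k /
      (1 + exp (y (t - \<mu> k t)) powr n k))) - b t * exp (y t)" for t
    by (simp add: G_def right_diff_distrib sum_distrib_left powr_def exp_diff mult.commute
        mult.left_commute)
  then have "((\<lambda>t. exp (y t)) has_real_derivative
      (\<Sum>k=1..M. lam k * r k t * (exp (y (t - \<tau> k t)) powr m k /
      (1 + exp (y (t - \<mu> k t)) powr n k))) - b t * exp (y t)) (at t)" for t
    using DERIV_fun_exp[OF y(1), of t] by simp
  then show ?thesis
    using y(2) by (simp add: positive_periodic_solutions_def periodic_fun_simple_def)
qed

text \<open>Solutions in adjacent strips could only agree in the constant function on the common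
  boundary, where the field does not vanish.\<close>

lemma log_solutions_distinct:
  assumes "x \<in> log_solutions c \<gamma>" "y \<in> log_solutions \<gamma>' d" "\<gamma> < \<gamma>' \<or> \<gamma> = \<gamma>' \<and> (rises d \<gamma> \<or> falls d \<gamma>)"
  shows "(\<lambda>t. exp (x t)) \<noteq> (\<lambda>t. exp (y t))"
proof
  assume "(\<lambda>t. exp (x t)) = (\<lambda>t. exp (y t))"
  then have "x = y" by (metis exp_inj_iff ext)
  have x: "x t \<le> \<gamma>" and y: "\<gamma>' \<le> y t" "y t \<le> d" "osc y" "(y has_real_derivative G y t) (at t)" for t
    using assms(1,2) by (auto simp: log_solutions_def strip_def)
  from x[of 0] y(1)[of 0] \<open>x = y\<close> have "\<not> \<gamma> < \<gamma>'" by simp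
  with assms(3) have "\<gamma> = \<gamma>'" and turn: "rises d \<gamma> \<or> falls d \<gamma>" by auto
  have const: "y t = \<gamma>" for t using x[of t] y(1)[of t] \<open>x = y\<close> \<open>\<gamma> = \<gamma>'\<close> by simp
  then have "y = (\<lambda>_. \<gamma>)" by auto
  then have "(y has_real_derivative 0) (at 0)" by simp
  then have "G y 0 = 0" using y(4) DERIV_unique by blast
  moreover have "0 < G y 0 \<or> G y 0 < 0"
    using turn y(2,3) const unfolding rises_def falls_def by blast
  ultimately show False by simp
qed

section \<open>Comparison of the field with \<open>alpha\<close> and \<open>beta\<close>, and the
  resulting levels\<close>

definition W :: "real \<Rightarrow> real \<Rightarrow> real \<Rightarrow> real \<Rightarrow> real" where
  "W p q \<gamma> t = (\<Sum>k=1..M. lam k * r k t * (exp (m k * p - \<gamma>) / (1 + exp (n k * q)))) - b t"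

lemma alpha_eq_W: "alpha T M lam m n r b \<gamma> t = W (\<gamma> - C) (\<gamma> + C) \<gamma> t"
  unfolding alpha_def W_def
  by (simp add: exp_add[symmetric] algebra_simps)

lemma beta_eq_W: "beta T M lam m n r b \<gamma> t = W (\<gamma> + C) (\<gamma> - C) \<gamma> t"
  unfolding beta_def W_def
  by (simp add: exp_add[symmetric] algebra_simps)

text \<open>As \<open>m k\<close> and \<open>n k\<close> are positive, a summand increases with the
  delayed value in its numerator and decreases with the one in its denominator. Extreme values
  therefore pair opposite ends of the range: \<open>\<gamma> - C\<close> with
  \<open>\<gamma> + C\<close> in \<open>alpha\<close>, the reverse in \<open>beta\<close>.\<close>

lemma W_le_G:
  assumes "\<And>s. p \<le> u s" "\<And>s. u s \<le> q"
  shows "W p q (u t) t \<le> G u t"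
  unfolding W_def G_def
proof (intro diff_right_mono sum_mono mult_left_mono frac_le)
  fix k assume k: "k \<in> {1..M}"
  show "exp (m k * p - u t) \<le> exp (m k * u (t - \<tau> k t) - u t)"
    "1 + exp (n k * u (t - \<mu> k t)) \<le> 1 + exp (n k * q)"
    using assms coeff_pos[OF k] by auto
  show "0 \<le> lam k * r k t" using weight_pos[OF k] by (simp add: less_imp_le)
qed (auto simp: one_plus_exp_pos)

lemma G_le_W:
  assumes "\<And>s. u s \<le> p" "\<And>s. q \<le> u s"
  shows "G u t \<le> W p q (u t) t"
  unfolding W_def G_def
proof (intro diff_right_mono sum_mono mult_left_mono frac_le)
  fix k assume k: "k \<in> {1..M}"
  show "exp (m k * u (t - \<tau> k t) - u t) \<le> exp (m k * p - u t)"
    "1 + exp (n k * q) \<le> 1 + exp (n k * u (t - \<mu> k t))"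
    using assms coeff_pos[OF k] by auto
  show "0 \<le> lam k * r k t" using weight_pos[OF k] by (simp add: less_imp_le)
qed (auto simp: one_plus_exp_pos)

lemma osc_bounds: "osc u \<Longrightarrow> u t - C \<le> u s \<and> u s \<le> u t + C"
  unfolding osc_def by (simp add: le_diff_eq[symmetric] diff_le_eq)

text \<open>The oscillation bound confines all values to within \<open>C\<close> of
  \<open>\<gamma>\<close>. The ceiling \<open>d\<close> is arbitrary, so the same level can close
  the strip below it and open the strip above it.\<close>

lemma rises_alpha:
  assumes "\<And>t. 0 < alpha T M lam m n r b \<gamma> t"
  shows "rises d \<gamma>"
  unfolding rises_def
proof (intro allI impI)
  fix u t assume "osc u" "u t = \<gamma>"
  then have "W (\<gamma> - C) (\<gamma> + C) (u t) t \<le> G u t"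
    using osc_bounds by (intro W_le_G) blast+
  then show "0 < G u t" using assms[of t] \<open>u t = \<gamma>\<close> by (simp add: alpha_eq_W)
qed

lemma falls_beta:
  assumes "\<And>t. beta T M lam m n r b \<gamma> t < 0"
  shows "falls d \<gamma>"
  unfolding falls_def
proof (intro allI impI)
  fix u t assume "osc u" "u t = \<gamma>"
  then have "G u t \<le> W (\<gamma> + C) (\<gamma> - C) (u t) t"
    using osc_bounds by (intro G_le_W) blast+
  then show "G u t < 0" using assms[of t] \<open>u t = \<gamma>\<close> by (simp add: beta_eq_W)
qed

text \<open>At low levels the one summand with \<open>m i < 1\<close> outgrows every bound, and the
  other summands are nonnegative. The minimum of \<open>r i\<close> and a bound on \<open>b\<close>
  make this uniform in \<open>t\<close>.\<close>

lemma rises_at_bot: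
  assumes i: "i \<in> {1..M}" "m i < 1"
  shows "\<forall>\<^sub>F \<gamma> in at_bot. rises d \<gamma>"
proof -
  obtain t0 where t0: "\<And>t. r i t0 \<le> r i t"
    using periodic_attains_inf[OF r_facts(3)[OF i(1)] T_pos r_facts(1)[OF i(1)]] by blast
  obtain B where B: "\<And>t. \<bar>b t\<bar> \<le> B"
    using periodic_bounded[OF b_facts(3) T_pos b_facts(1)] by blast
  have pos: "0 < lam i * r i t0" by (rule weight_pos[OF i(1)])
  have "0 < n i" using coeff_pos[OF i(1)] by simp
  from growth_quotient_at_bot_infinity[OF i(2) this, of C]
  have "\<forall>\<^sub>F \<gamma> in at_bot. B / (lam i * r i t0) <
      exp (m i * (\<gamma> - C) - \<gamma>) / (1 + exp (n i * (\<gamma> + C)))"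
    by (simp add: filterlim_at_top_dense)
  then show ?thesis
  proof eventually_elim
    case (elim \<gamma>)
    show ?case
    proof (rule rises_alpha)
      fix t
      let ?q = "\<lambda>k. exp (m k * (\<gamma> - C) - \<gamma>) / (1 + exp (n k * (\<gamma> + C)))"
      have q: "0 \<le> ?q k" for k by (simp add: less_imp_le one_plus_exp_pos)
      have "b t \<le> B" using B[of t] by linarith
      also have "B < lam i * r i t0 * ?q i" using elim pos by (simp add: divide_less_eq mult.commute)
      also have "\<dots> \<le> lam i * r i t * ?q i"
        using t0 coeff_pos[OF i(1)] q by (intro mult_right_mono mult_left_mono) (auto simp: less_imp_le)
      also have "\<dots> \<le> (\<Sum>k=1..M. lam k * r k t * ?q k)"
        using term_nonneg i(1)
        by (intro member_le_sum[of i _ "\<lambda>k. lam k * r k t * ?q k"]) auto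
      finally show "0 < alpha T M lam m n r b \<gamma> t" by (simp add: alpha_eq_W W_def)
    qed
  qed
qed

text \<open>With all exponents above 1, every quotient in \<open>beta\<close> tends to 0 at low
  levels, and the negative term \<open>- b\<close> prevails.\<close>

lemma falls_at_bot:
  assumes "\<And>k. k \<in> {1..M} \<Longrightarrow> 1 < m k"
  shows "\<forall>\<^sub>F \<gamma> in at_bot. falls d \<gamma>"
proof -
  have "\<forall>\<^sub>F \<gamma> in at_bot. \<forall>t. (\<Sum>k=1..M. lam k * r k t *
      (exp (m k * (\<gamma> + C) - \<gamma>) / (1 + exp (n k * (\<gamma> - C))))) < b t"
  proof (rule eventually_uniform_sum_less[OF _ T_pos _ b_facts(1,3)])
    show "((\<lambda>\<gamma>. exp (m k * (\<gamma> + C) - \<gamma>) / (1 + exp (n k * (\<gamma> - C)))) \<longlongrightarrow> 0) at_bot"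
      if "k \<in> {1..M}" for k
      using growth_quotient_at_bot_zero assms[OF that] coeff_pos[OF that] by blast
  qed (use weight_periodic b_facts(2) in auto)
  then show ?thesis
    by eventually_elim (rule falls_beta, simp add: beta_eq_W W_def)
qed

text \<open>When the current value is the ceiling, the delayed values lie between
  \<open>d - C\<close> and \<open>d\<close>. As \<open>d\<close> grows, the summands with
  \<open>m k < n k + 1\<close> fade and only the critical weights survive.\<close>

lemma falls_at_top:
  assumes le: "\<And>k. k \<in> {1..M} \<Longrightarrow> m k \<le> n k + 1"
    and less: "\<And>t. (\<Sum>k\<in>M4 M m n. lam k * r k t * exp (C * n k)) < b t"
  shows "\<forall>\<^sub>F d in at_top. falls d d"
proof -
  have "\<forall>\<^sub>F d in at_top. \<forall>t. (\<Sum>k=1..M. lam k * r k t *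
      (exp (m k * d - d) / (1 + exp (n k * (d - C))))) < b t"
  proof (rule eventually_uniform_sum_less[OF _ T_pos _ b_facts(1,3)])
    show "((\<lambda>d. exp (m k * d - d) / (1 + exp (n k * (d - C)))) \<longlongrightarrow>
        (if m k = n k + 1 then exp (C * n k) else 0)) at_top" if "k \<in> {1..M}" for k
      using growth_quotient_at_top_zero[of "m k" "n k" C]
        growth_quotient_at_top_critical[of "n k" C] le[OF that] coeff_pos[OF that] by auto
    show "(\<Sum>k=1..M. lam k * r k t * (if m k = n k + 1 then exp (C * n k) else 0)) < b t" for t
    proof -
      have "(\<Sum>k=1..M. lam k * r k t * (if m k = n k + 1 then exp (C * n k) else 0))
          = (\<Sum>k\<in>M4 M m n. lam k * r k t * exp (C * n k))"
        unfolding M4_def by (rule sum.mono_neutral_cong_right) auto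
      then show ?thesis using less by simp
    qed
  qed (use weight_periodic in auto)
  then show ?thesis
  proof eventually_elim
    case (elim d)
    show ?case unfolding falls_def
    proof (intro allI impI)
      fix u t assume u: "osc u" "\<forall>s. u s \<le> d" "u t = d"
      have "d - C \<le> u s" for s using osc_bounds[OF u(1), of t s] u(3) by simp
      then have "G u t \<le> W d (d - C) (u t) t" using u by (intro G_le_W) auto
      then show "G u t < 0" using elim u(3) by (auto simp: W_def dest!: spec[of _ t])
    qed
  qed
qed

text \<open>Only the critical summands are kept, the others being nonnegative. Negated weights turn
  the lower estimate into an instance of \<open>eventually_uniform_sum_less\<close>.\<close>

lemma rises_at_top:
  assumes less: "\<And>t. b t < (\<Sum>k\<in>M4 M m n. lam k * r k t * exp (- C * m k))"
  shows "\<forall>\<^sub>F d in at_top. rises d d"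
proof -
  let ?q = "\<lambda>k d. exp (m k * (d - C) - d) / (1 + exp (n k * d))"
  have M4: "k \<in> {1..M}" "m k = n k + 1" if "k \<in> M4 M m n" for k using that by (auto simp: M4_def)
  have "\<forall>\<^sub>F d in at_top. \<forall>t. (\<Sum>k\<in>M4 M m n. - (lam k * r k t) * ?q k d) < - b t"
  proof (rule eventually_uniform_sum_less[OF _ T_pos])
    show "(?q k \<longlongrightarrow> exp (- C * m k)) at_top" if "k \<in> M4 M m n" for k
      using growth_quotient_at_top_critical'[of "n k" C] M4[OF that] coeff_pos by auto
    show "continuous_on UNIV (\<lambda>t. - (lam k * r k t)) \<and> periodic_fun_simple (\<lambda>t. - (lam k * r k t)) T"
      if "k \<in> M4 M m n" for k
      using weight_periodic[OF M4(1)[OF that]]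
      by (auto intro: continuous_on_minus simp: periodic_fun_simple_def)
    show "(\<Sum>k\<in>M4 M m n. - (lam k * r k t) * exp (- C * m k)) < - b t" for t
      using less[of t] by (simp add: sum_negf)
  qed (use b_facts in \<open>auto simp: M4_def periodic_fun_simple_def intro: continuous_on_minus\<close>)
  then show ?thesis
  proof eventually_elim
    case (elim d)
    show ?case unfolding rises_def
    proof (intro allI impI)
      fix u t assume u: "osc u" "\<forall>s. u s \<le> d" "u t = d"
      have "d - C \<le> u s" for s using osc_bounds[OF u(1), of t s] u(3) by simp
      then have WG: "W (d - C) d (u t) t \<le> G u t" using u by (intro W_le_G) auto
      have "b t < (\<Sum>k\<in>M4 M m n. lam k * r k t * ?q k d)"
        using elim[rule_format, of t] by (simp add: sum_negf)
      also have "\<dots> \<le> (\<Sum>k=1..M. lam k * r k t * ?q k d)"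
        by (rule sum_mono2) (use M4(1) term_nonneg in auto)
      finally show "0 < G u t" using WG u(3) by (simp add: W_def)
    qed
  qed
qed

section \<open>Counting solutions by the sign pattern of the levels\<close>

abbreviation "solutions \<equiv> positive_periodic_solutions T M lam m n r \<tau> \<mu> b"

text \<open>The field falls, rises and falls at levels \<open>c < \<gamma> < d\<close>, which leaves
  a repelling strip below an attracting one.\<close>

lemma two_solutions_superlinear:
  assumes m: "\<And>k. k \<in> {1..M} \<Longrightarrow> 1 < m k" and le: "\<And>k. k \<in> {1..M} \<Longrightarrow> m k \<le> n k + 1"
    and less: "\<And>t. (\<Sum>k\<in>M4 M m n. lam k * r k t * exp (C * n k)) < b t"
    and \<alpha>: "\<And>t. 0 < alpha T M lam m n r b \<gamma> t"
  shows "has_at_least 2 solutions"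
proof -
  obtain c where c: "c < \<gamma>" "falls \<gamma> c" by (rule below_at_bot[OF falls_at_bot[OF m]])
  obtain d where d: "\<gamma> < d" "falls d d" by (rule above_at_top[OF falls_at_top[OF le less]])
  have \<gamma>: "rises e \<gamma>" for e by (rule rises_alpha[OF \<alpha>])
  obtain x where x: "x \<in> log_solutions c \<gamma>"
    by (rule repelling_strip[OF less_imp_le[OF c(1)] c(2) \<gamma>])
  obtain y where y: "y \<in> log_solutions \<gamma> d"
    by (rule attracting_strip[OF less_imp_le[OF d(1)] \<gamma> d(2)])
  show ?thesis
    by (rule has_at_least_2I[OF exp_log_solution[OF x] exp_log_solution[OF y]],
        rule log_solutions_distinct[OF x y]) (simp add: \<gamma>)
qed

text \<open>The mirrored pattern: the field rises, falls and rises, so the lower strip attracts and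
  the upper one repels.\<close>

lemma two_solutions_sublinear:
  assumes i: "i \<in> {1..M}" "m i < 1"
    and less: "\<And>t. b t < (\<Sum>k\<in>M4 M m n. lam k * r k t * exp (- C * m k))"
    and \<beta>: "\<And>t. beta T M lam m n r b \<gamma> t < 0"
  shows "has_at_least 2 solutions"
proof -
  obtain c where c: "c < \<gamma>" "rises \<gamma> c" by (rule below_at_bot[OF rises_at_bot[OF i]])
  obtain d where d: "\<gamma> < d" "rises d d" by (rule above_at_top[OF rises_at_top[OF less]])
  have \<gamma>: "falls e \<gamma>" for e by (rule falls_beta[OF \<beta>])
  obtain x where x: "x \<in> log_solutions c \<gamma>"
    by (rule attracting_strip[OF less_imp_le[OF c(1)] c(2) \<gamma>])
  obtain y where y: "y \<in> log_solutions \<gamma> d"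
    by (rule repelling_strip[OF less_imp_le[OF d(1)] \<gamma> d(2)])
  show ?thesis
    by (rule has_at_least_2I[OF exp_log_solution[OF x] exp_log_solution[OF y]],
        rule log_solutions_distinct[OF x y]) (simp add: \<gamma>)
qed

text \<open>At \<open>c < \<gamma>1 < \<gamma>2 < d\<close> the field alternates, beginning with a
  rise, so the strips attract, repel and attract. The two outer strips are disjoint; neighbouring
  ones are told apart at their common level.\<close>

lemma three_solutions:
  assumes i: "i \<in> {1..M}" "m i < 1" and le: "\<And>k. k \<in> {1..M} \<Longrightarrow> m k \<le> n k + 1"
    and less: "\<And>t. (\<Sum>k\<in>M4 M m n. lam k * r k t * exp (C * n k)) < b t"
    and "\<gamma>1 < \<gamma>2" and \<alpha>: "\<And>t. 0 < alpha T M lam m n r b \<gamma>2 t"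
    and \<beta>: "\<And>t. beta T M lam m n r b \<gamma>1 t < 0"
  shows "has_at_least 3 solutions"
proof -
  obtain c where c: "c < \<gamma>1" "rises \<gamma>1 c" by (rule below_at_bot[OF rises_at_bot[OF i]])
  obtain d where d: "\<gamma>2 < d" "falls d d" by (rule above_at_top[OF falls_at_top[OF le less]])
  have \<gamma>1: "falls e \<gamma>1" for e by (rule falls_beta[OF \<beta>])
  have \<gamma>2: "rises e \<gamma>2" for e by (rule rises_alpha[OF \<alpha>])
  obtain x where x: "x \<in> log_solutions c \<gamma>1"
    by (rule attracting_strip[OF less_imp_le[OF c(1)] c(2) \<gamma>1])
  obtain y where y: "y \<in> log_solutions \<gamma>1 \<gamma>2"
    by (rule repelling_strip[OF less_imp_le[OF \<open>\<gamma>1 < \<gamma>2\<close>] \<gamma>1 \<gamma>2])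
  obtain z where z: "z \<in> log_solutions \<gamma>2 d"
    by (rule attracting_strip[OF less_imp_le[OF d(1)] \<gamma>2 d(2)])
  show ?thesis
  proof (rule has_at_least_3I[OF exp_log_solution[OF x] exp_log_solution[OF y]
        exp_log_solution[OF z]])
    show "(\<lambda>t. exp (x t)) \<noteq> (\<lambda>t. exp (y t))" by (rule log_solutions_distinct[OF x y]) (simp add: \<gamma>1)
    show "(\<lambda>t. exp (y t)) \<noteq> (\<lambda>t. exp (z t))" by (rule log_solutions_distinct[OF y z]) (simp add: \<gamma>2)
    show "(\<lambda>t. exp (x t)) \<noteq> (\<lambda>t. exp (z t))"
      by (rule log_solutions_distinct[OF x z]) (simp add: \<open>\<gamma>1 < \<gamma>2\<close>)
  qed
qed

end

theorem theorem3p3: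
  fixes T :: real and M :: nat
    and lam m n :: "nat \<Rightarrow> real"
    and r \<tau> \<mu> :: "nat \<Rightarrow> real \<Rightarrow> real"
    and b :: "real \<Rightarrow> real"
  assumes "T > 0" and "M \<ge> 1"
    and "\<forall>k\<in>{1..M}. lam k > 0 \<and> m k > 0 \<and> n k > 0"
    and "\<forall>k\<in>{1..M}. continuous_positive_periodic T (r k) \<and>
           continuous_positive_periodic T (\<tau> k) \<and> continuous_positive_periodic T (\<mu> k)"
    and "continuous_positive_periodic T b"
    and "\<forall>k\<in>{1..M}. m k \<le> n k + 1"
    and "\<exists>j\<in>{1..M}. m j = n j + 1"
  shows
    "((\<forall>k\<in>{1..M}. m k > 1) \<and> (\<exists>i\<in>{1..M}. 1 < m i \<and> m i < n i + 1) \<and>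
      (\<forall>t. (\<Sum>k\<in>M4 M m n. lam k * r k t * exp (Cint T b * n k)) < b t) \<and>
      (\<exists>\<gamma>1. \<forall>t. alpha T M lam m n r b \<gamma>1 t > 0)
        \<longrightarrow> has_at_least 2 (positive_periodic_solutions T M lam m n r \<tau> \<mu> b))
   \<and> ((\<exists>i\<in>{1..M}. 0 < m i \<and> m i < 1) \<and> (\<forall>k\<in>{1..M}. m k \<notin> {1<..<n k + 1}) \<and>
      (\<forall>t. (\<Sum>k\<in>M4 M m n. lam k * r k t * exp (- Cint T b * m k)) > b t) \<and>
      (\<exists>\<gamma>1. \<forall>t. beta T M lam m n r b \<gamma>1 t < 0)
        \<longrightarrow> has_at_least 2 (positive_periodic_solutions T M lam m n r \<tau> \<mu> b))
   \<and> ((\<exists>i\<in>{1..M}. 0 < m i \<and> m i < 1) \<and> (\<exists>s\<in>{1..M}. 1 < m s \<and> m s < n s + 1) \<and>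
      (\<forall>t. (\<Sum>k\<in>M4 M m n. lam k * r k t * exp (Cint T b * n k)) < b t) \<and>
      (\<exists>\<gamma>1 \<gamma>2. \<gamma>1 < \<gamma>2 \<and>
         (\<forall>t. alpha T M lam m n r b \<gamma>2 t > 0 \<and> 0 > beta T M lam m n r b \<gamma>1 t))
        \<longrightarrow> has_at_least 3 (positive_periodic_solutions T M lam m n r \<tau> \<mu> b))"
proof -
  interpret delay_equation T M lam m n r \<tau> \<mu> b
    using assms by unfold_locales auto
  have le: "m k \<le> n k + 1" if "k \<in> {1..M}" for k using assms(6) that by blast
  show ?thesis
  proof (intro conjI impI, goal_cases)
    case 1
    then obtain \<gamma> where "\<forall>t. alpha T M lam m n r b \<gamma> t > 0" by blast
    with 1 show ?case by (intro two_solutions_superlinear[of \<gamma>] le) simp_all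
  next
    case 2
    then obtain \<gamma> i where "\<forall>t. beta T M lam m n r b \<gamma> t < 0" "i \<in> {1..M}" "m i < 1" by blast
    with 2 show ?case by (intro two_solutions_sublinear[of i \<gamma>]) simp_all
  next
    case 3
    then obtain \<gamma>1 \<gamma>2 i where "\<gamma>1 < \<gamma>2" "i \<in> {1..M}" "m i < 1"
      "\<forall>t. alpha T M lam m n r b \<gamma>2 t > 0 \<and> 0 > beta T M lam m n r b \<gamma>1 t" by blast
    with 3 show ?case by (intro three_solutions[of i \<gamma>1 \<gamma>2] le) simp_all
  qed
qed

end
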